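(* Let $\mathcal{T}_\alpha=(\mathcal{K}_\alpha,\mathcal{F})$, with weights $c,r,s$, be a $\chi$-complete weighted magnetic triangulation. Then the magnetic Gauss-Bonnet operator $T_\alpha$ is essentially self-adjoint on $\mathcal{C}^c(\mathcal{V})\oplus\mathcal{C}^c_{skew}(\mathcal{E})\oplus\mathcal{C}^c_{skew}(\mathcal{F})$, as an operator in the Hilbert space $l^2(\mathcal{T}_\alpha)=l^2(\mathcal{V})\oplus l^2(\mathcal{E})\oplus l^2(\mathcal{F})$.
   Context: Magnetic triangulation. A graph $(\mathcal{V},\mathcal{E})$ consists of an at most countable set $\mathcal{V}$ and a symmetric set $\mathcal{E}\subset\mathcal{V}\times\mathcal{V}$ of (oriented) edges without loops ($(x,x)\notin\mathcal{E}$); it is assumed connected and locally finite (each vertex has finitely many neighbours). For $e=(x,y)\in\mathcal{E}$ put $e^-=x$, $e^+=y$; $x\sim y$ means $(x,y)\in\mathcal{E}$. A magnetic potential is a function $\alpha:\mathcal{E}\to\mathbb{R}$ with $\alpha(x,y)=-\alpha(y,x)$, and $\mathcal{K}_\alpha=(\mathcal{V},\mathcal{E},\alpha)$. A symmetric set of triangular faces is a set $\mathcal{F}\subset\mathcal{V}^3$, stable under all permutations of the three entries, such that $(x,y,z)\in\mathcal{F}$ implies that $x,y,z$ are pairwise adjacent (not every 3-cycle needs to be a face). $\mathcal{T}_\alpha=(\mathcal{K}_\alpha,\mathcal{F})$ is a magnetic triangulation. For an edge $(x,y)$ put $\mathcal{F}_{xy}=\{z\in\mathcal{V}:(x,y,z)\in\mathcal{F}\}$.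 Weights: $c:\mathcal{V}\to(0,\infty)$; $r:\mathcal{E}\to(0,\infty)$ symmetric; $s:\mathcal{F}\to(0,\infty)$ invariant under all permutations. Spaces: $\mathcal{C}(\mathcal{V})$ is the set of functions $\mathcal{V}\to\mathbb{C}$; $\mathcal{C}_{skew}(\mathcal{E})$ is the set of $\varphi:\mathcal{E}\to\mathbb{C}$ with $\varphi(x,y)=-\varphi(y,x)$; $\mathcal{C}_{skew}(\mathcal{F})$ is the set of $\psi:\mathcal{F}\to\mathbb{C}$ that are alternating under permutations of the entries. A superscript $c$ denotes the subspace of finitely supported functions. The Hilbert spaces $l^2(\mathcal{V}),l^2(\mathcal{E}),l^2(\mathcal{F})$ consist of the elements of these spaces with finite norm for $\langle f_1,f_2\rangle=\sum_x c(x)f_1(x)\overline{f_2(x)}$, $\langle\varphi_1,\varphi_2\rangle=\frac12\sum_{e\in\mathcal{E}}r(e)\varphi_1(e)\overline{\varphi_2(e)}$, $\langle\psi_1,\psi_2\rangle=\frac16\sum_{(x,y,z)\in\mathcal{F}}s(x,y,z)\psi_1(x,y,z)\overline{\psi_2(x,y,z)}$. Operators: $d^0_\alpha g(x,y)=e^{\frac{i\alpha(y,x)}{2}}g(y)-e^{\frac{i\alpha(x,y)}{2}}g(x)$; $\delta^0_\alpha\varphi(x)=\frac1{c(x)}\sum_{e\in\mathcal{E},\,e^+=x}r(e)e^{i\alpha(e)/2}\varphi(e)$; $d^1_\alpha\varphi(x,y,z)=e^{\frac i6(\alpha(x,z)+\alpha(y,z))}\varphi(x,y)+e^{\frac i6(\alpha(y,x)+\alpha(z,x))}\varphi(y,z)+e^{\frac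 i6(\alpha(z,y)+\alpha(x,y))}\varphi(z,x)$; $\delta^1_\alpha\psi(x,y)=\frac1{r(x,y)}\sum_{t\in\mathcal{F}_{xy}}s(x,y,t)e^{\frac i6(\alpha(t,x)+\alpha(t,y))}\psi(x,y,t)$. ($\delta^j_\alpha$ is the formal adjoint of $d^j_\alpha$.) The magnetic Gauss-Bonnet operator is $T_\alpha(f,\varphi,\psi)=(\delta^0_\alpha\varphi,\ d^0_\alpha f+\delta^1_\alpha\psi,\ d^1_\alpha\varphi)$ with domain $\mathcal{C}^c(\mathcal{V})\oplus\mathcal{C}^c_{skew}(\mathcal{E})\oplus\mathcal{C}^c_{skew}(\mathcal{F})$. $\chi$-completeness: let $d^0f(x,y)=f(y)-f(x)$. The weighted triangulation is $\chi$-complete if there are a constant $C>0$, an increasing sequence of finite sets $(B_n)_{n\in\mathbb{N}}$ with $\mathcal{V}=\bigcup_nB_n$, and functions $\chi_n\in\mathcal{C}^c(\mathcal{V})$ with $0\le\chi_n\le1$ and $\chi_n=1$ on $B_n$, such that for all $n$: for all $x\in\mathcal{V}$, $\frac1{c(x)}\sum_{e\in\mathcal{E},\,e^+=x}r(e)|d^0\chi_n(e)|^2\le C$; and for all $(x,y)\in\mathcal{E}$, $\frac1{r(x,y)}\sum_{t\in\mathcal{F}_{xy}}s(x,y,t)\,|d^0\chi_n(t,x)+d^0\chi_n(t,y)|^2\le C$. *)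

theory Defs
  imports "HOL-Analysis.Analysis"
begin

section \<open>Operators in a Hilbert space\<close>

text \<open>
  A Hilbert space is given by a carrier \<open>H\<close> and an inner product \<open>ip\<close>, linear in its first
  argument. An operator is treated through its graph, a subset of \<open>H \<times> H\<close>.
\<close>

definition ip_norm :: "('h \<Rightarrow> 'h \<Rightarrow> complex) \<Rightarrow> 'h \<Rightarrow> real" where
  "ip_norm ip u = sqrt (Re (ip u u))"

definition dense_subset :: "'h::minus set \<Rightarrow> ('h \<Rightarrow> 'h \<Rightarrow> complex) \<Rightarrow> 'h set \<Rightarrow> bool" where
  "dense_subset H ip D \<longleftrightarrow> D \<subseteq> H \<and> (\<forall>u\<in>H. \<forall>\<epsilon>>0. \<exists>v\<in>D. ip_norm ip (v - u) < \<epsilon>)"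

definition op_graph :: "'h set \<Rightarrow> ('h \<Rightarrow> 'h) \<Rightarrow> ('h \<times> 'h) set" where
  "op_graph D T = {(u, T u) |u. u \<in> D}"

definition closure_graph ::
    "'h::minus set \<Rightarrow> ('h \<Rightarrow> 'h \<Rightarrow> complex) \<Rightarrow> ('h \<times> 'h) set \<Rightarrow> ('h \<times> 'h) set" where
  "closure_graph H ip G = {(u, v) \<in> H \<times> H. \<exists>a b. (\<forall>n::nat. (a n, b n) \<in> G) \<and>
     (\<lambda>n. ip_norm ip (a n - u)) \<longlonglongrightarrow> 0 \<and> (\<lambda>n. ip_norm ip (b n - v)) \<longlonglongrightarrow> 0}"

definition adjoint_graph ::
    "'h set \<Rightarrow> ('h \<Rightarrow> 'h \<Rightarrow> complex) \<Rightarrow> ('h \<times> 'h) set \<Rightarrow> ('h \<times> 'h) set" where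
  "adjoint_graph H ip G = {(u, v) \<in> H \<times> H. \<forall>(x, y) \<in> G. ip y u = ip x v}"

text \<open>
  Linearity need not be demanded here: an adjoint graph is always a linear relation.
\<close>

definition selfadjoint_graph ::
    "'h::minus set \<Rightarrow> ('h \<Rightarrow> 'h \<Rightarrow> complex) \<Rightarrow> ('h \<times> 'h) set \<Rightarrow> bool" where
  "selfadjoint_graph H ip G \<longleftrightarrow>
     single_valued G \<and> dense_subset H ip (Domain G) \<and> adjoint_graph H ip G = G"

definition essentially_selfadjoint ::
    "'h::minus set \<Rightarrow> ('h \<Rightarrow> 'h \<Rightarrow> complex) \<Rightarrow> 'h set \<Rightarrow> ('h \<Rightarrow> 'h) \<Rightarrow> bool" where
  "essentially_selfadjoint H ip D T \<longleftrightarrow>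
     dense_subset H ip D \<and> T ` D \<subseteq> H \<and>
     (\<forall>u\<in>D. \<forall>v\<in>D. ip (T u) v = ip u (T v)) \<and>
     selfadjoint_graph H ip (closure_graph H ip (op_graph D T))"

section \<open>Weighted magnetic triangulations\<close>

locale magnetic_graph =
  fixes V :: "'a set" and E :: "('a \<times> 'a) set" and \<alpha> :: "'a \<times> 'a \<Rightarrow> real"
  assumes countable_V: "countable V"
    and E_subset: "E \<subseteq> V \<times> V"
    and sym_E: "sym E"
    and irrefl_E: "irrefl E"
    and connected_E: "\<And>x y. x \<in> V \<Longrightarrow> y \<in> V \<Longrightarrow> (x, y) \<in> E\<^sup>*"
    and locally_finite: "\<And>x. x \<in> V \<Longrightarrow> finite {y. (x, y) \<in> E}"
    and alpha_skew: "\<And>x y. (x, y) \<in> E \<Longrightarrow> \<alpha> (x, y) = - \<alpha> (y, x)"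

text \<open>
  Invariance under all permutations of three entries is expressed through the generators
  \<open>(x, y, z) \<mapsto> (y, x, z)\<close> and \<open>(x, y, z) \<mapsto> (y, z, x)\<close> of the symmetric group.
\<close>

locale magnetic_triangulation = magnetic_graph V E \<alpha>
  for V :: "'a set" and E :: "('a \<times> 'a) set" and \<alpha> :: "'a \<times> 'a \<Rightarrow> real" +
  fixes F :: "('a \<times> 'a \<times> 'a) set"
  assumes F_swap: "\<And>x y z. (x, y, z) \<in> F \<Longrightarrow> (y, x, z) \<in> F"
    and F_rotate: "\<And>x y z. (x, y, z) \<in> F \<Longrightarrow> (y, z, x) \<in> F"
    and F_edges: "\<And>x y z. (x, y, z) \<in> F \<Longrightarrow> (x, y) \<in> E \<and> (y, z) \<in> E \<and> (z, x) \<in> E"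

locale weighted_magnetic_triangulation = magnetic_triangulation V E \<alpha> F
  for V :: "'a set" and E :: "('a \<times> 'a) set" and \<alpha> :: "'a \<times> 'a \<Rightarrow> real"
    and F :: "('a \<times> 'a \<times> 'a) set" +
  fixes c :: "'a \<Rightarrow> real" and r :: "'a \<times> 'a \<Rightarrow> real" and s :: "'a \<times> 'a \<times> 'a \<Rightarrow> real"
  assumes c_pos: "\<And>x. x \<in> V \<Longrightarrow> c x > 0"
    and r_pos: "\<And>e. e \<in> E \<Longrightarrow> r e > 0"
    and r_sym: "\<And>x y. (x, y) \<in> E \<Longrightarrow> r (x, y) = r (y, x)"
    and s_pos: "\<And>t. t \<in> F \<Longrightarrow> s t > 0"
    and s_swap: "\<And>x y z. (x, y, z) \<in> F \<Longrightarrow> s (y, x, z) = s (x, y, z)"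
    and s_rotate: "\<And>x y z. (x, y, z) \<in> F \<Longrightarrow> s (y, z, x) = s (x, y, z)"

definition face_set :: "('a \<times> 'a \<times> 'a) set \<Rightarrow> 'a \<Rightarrow> 'a \<Rightarrow> 'a set" where
  "face_set F x y = {z. (x, y, z) \<in> F}"

section \<open>Function spaces\<close>

text \<open>
  A function on \<open>V\<close>, \<open>E\<close> or \<open>F\<close> is represented by its extension by zero to the whole type.
\<close>

definition fun_V :: "'a set \<Rightarrow> ('a \<Rightarrow> complex) set" where
  "fun_V V = {f. \<forall>x. x \<notin> V \<longrightarrow> f x = 0}"

definition skew_E :: "('a \<times> 'a) set \<Rightarrow> ('a \<times> 'a \<Rightarrow> complex) set" where
  "skew_E E = {\<phi>. (\<forall>e. e \<notin> E \<longrightarrow> \<phi> e = 0) \<and> (\<forall>x y. (x, y) \<in> E \<longrightarrow> \<phi> (x, y) = - \<phi> (y, x))}"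

definition skew_F :: "('a \<times> 'a \<times> 'a) set \<Rightarrow> ('a \<times> 'a \<times> 'a \<Rightarrow> complex) set" where
  "skew_F F = {\<psi>. (\<forall>t. t \<notin> F \<longrightarrow> \<psi> t = 0) \<and>
     (\<forall>x y z. (x, y, z) \<in> F \<longrightarrow> \<psi> (y, x, z) = - \<psi> (x, y, z) \<and> \<psi> (y, z, x) = \<psi> (x, y, z))}"

definition fin_supp :: "('b \<Rightarrow> complex) \<Rightarrow> bool" where
  "fin_supp f \<longleftrightarrow> finite {x. f x \<noteq> 0}"

definition l2_V :: "'a set \<Rightarrow> ('a \<Rightarrow> real) \<Rightarrow> ('a \<Rightarrow> complex) set" where
  "l2_V V c = {f \<in> fun_V V. (\<lambda>x. c x * (cmod (f x))\<^sup>2) summable_on V}"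

definition l2_E :: "('a \<times> 'a) set \<Rightarrow> ('a \<times> 'a \<Rightarrow> real) \<Rightarrow> ('a \<times> 'a \<Rightarrow> complex) set" where
  "l2_E E r = {\<phi> \<in> skew_E E. (\<lambda>e. r e * (cmod (\<phi> e))\<^sup>2) summable_on E}"

definition l2_F :: "('a \<times> 'a \<times> 'a) set \<Rightarrow> ('a \<times> 'a \<times> 'a \<Rightarrow> real) \<Rightarrow> ('a \<times> 'a \<times> 'a \<Rightarrow> complex) set" where
  "l2_F F s = {\<psi> \<in> skew_F F. (\<lambda>t. s t * (cmod (\<psi> t))\<^sup>2) summable_on F}"

definition ip_V :: "'a set \<Rightarrow> ('a \<Rightarrow> real) \<Rightarrow> ('a \<Rightarrow> complex) \<Rightarrow> ('a \<Rightarrow> complex) \<Rightarrow> complex" where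
  "ip_V V c f g = (\<Sum>\<^sub>\<infinity>x\<in>V. of_real (c x) * f x * cnj (g x))"

definition ip_E :: "('a \<times> 'a) set \<Rightarrow> ('a \<times> 'a \<Rightarrow> real) \<Rightarrow>
    ('a \<times> 'a \<Rightarrow> complex) \<Rightarrow> ('a \<times> 'a \<Rightarrow> complex) \<Rightarrow> complex" where
  "ip_E E r \<phi> \<psi> = 1/2 * (\<Sum>\<^sub>\<infinity>e\<in>E. of_real (r e) * \<phi> e * cnj (\<psi> e))"

definition ip_F :: "('a \<times> 'a \<times> 'a) set \<Rightarrow> ('a \<times> 'a \<times> 'a \<Rightarrow> real) \<Rightarrow>
    ('a \<times> 'a \<times> 'a \<Rightarrow> complex) \<Rightarrow> ('a \<times> 'a \<times> 'a \<Rightarrow> complex) \<Rightarrow> complex" where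
  "ip_F F s \<phi> \<psi> = 1/6 * (\<Sum>\<^sub>\<infinity>t\<in>F. of_real (s t) * \<phi> t * cnj (\<psi> t))"

type_synonym 'a triple = "('a \<Rightarrow> complex) \<times> ('a \<times> 'a \<Rightarrow> complex) \<times> ('a \<times> 'a \<times> 'a \<Rightarrow> complex)"

definition l2_T :: "'a set \<Rightarrow> ('a \<times> 'a) set \<Rightarrow> ('a \<times> 'a \<times> 'a) set \<Rightarrow>
    ('a \<Rightarrow> real) \<Rightarrow> ('a \<times> 'a \<Rightarrow> real) \<Rightarrow> ('a \<times> 'a \<times> 'a \<Rightarrow> real) \<Rightarrow> 'a triple set" where
  "l2_T V E F c r s = l2_V V c \<times> l2_E E r \<times> l2_F F s"

definition ip_T :: "'a set \<Rightarrow> ('a \<times> 'a) set \<Rightarrow> ('a \<times> 'a \<times> 'a) set \<Rightarrow>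
    ('a \<Rightarrow> real) \<Rightarrow> ('a \<times> 'a \<Rightarrow> real) \<Rightarrow> ('a \<times> 'a \<times> 'a \<Rightarrow> real) \<Rightarrow>
    'a triple \<Rightarrow> 'a triple \<Rightarrow> complex" where
  "ip_T V E F c r s = (\<lambda>(f1, \<phi>1, \<psi>1) (f2, \<phi>2, \<psi>2).
     ip_V V c f1 f2 + ip_E E r \<phi>1 \<phi>2 + ip_F F s \<psi>1 \<psi>2)"

definition gb_domain :: "'a set \<Rightarrow> ('a \<times> 'a) set \<Rightarrow> ('a \<times> 'a \<times> 'a) set \<Rightarrow> 'a triple set" where
  "gb_domain V E F =
     {f \<in> fun_V V. fin_supp f} \<times> {\<phi> \<in> skew_E E. fin_supp \<phi>} \<times> {\<psi> \<in> skew_F F. fin_supp \<psi>}"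

section \<open>Magnetic operators\<close>

definition d0 :: "('a \<times> 'a) set \<Rightarrow> ('a \<times> 'a \<Rightarrow> real) \<Rightarrow> ('a \<Rightarrow> complex) \<Rightarrow> ('a \<times> 'a \<Rightarrow> complex)" where
  "d0 E \<alpha> g = (\<lambda>(x, y). if (x, y) \<in> E
     then cis (\<alpha> (y, x) / 2) * g y - cis (\<alpha> (x, y) / 2) * g x else 0)"

definition delta0 :: "'a set \<Rightarrow> ('a \<times> 'a) set \<Rightarrow> ('a \<times> 'a \<Rightarrow> real) \<Rightarrow> ('a \<Rightarrow> real) \<Rightarrow>
    ('a \<times> 'a \<Rightarrow> real) \<Rightarrow> ('a \<times> 'a \<Rightarrow> complex) \<Rightarrow> ('a \<Rightarrow> complex)" where
  "delta0 V E \<alpha> c r \<phi> = (\<lambda>x. if x \<in> V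
     then 1 / of_real (c x) * (\<Sum>e\<in>{e \<in> E. snd e = x}. of_real (r e) * cis (\<alpha> e / 2) * \<phi> e) else 0)"

definition d1 :: "('a \<times> 'a \<times> 'a) set \<Rightarrow> ('a \<times> 'a \<Rightarrow> real) \<Rightarrow>
    ('a \<times> 'a \<Rightarrow> complex) \<Rightarrow> ('a \<times> 'a \<times> 'a \<Rightarrow> complex)" where
  "d1 F \<alpha> \<phi> = (\<lambda>(x, y, z). if (x, y, z) \<in> F
     then cis ((\<alpha> (x, z) + \<alpha> (y, z)) / 6) * \<phi> (x, y)
        + cis ((\<alpha> (y, x) + \<alpha> (z, x)) / 6) * \<phi> (y, z)
        + cis ((\<alpha> (z, y) + \<alpha> (x, y)) / 6) * \<phi> (z, x) else 0)"

definition delta1 :: "('a \<times> 'a) set \<Rightarrow> ('a \<times> 'a \<times> 'a) set \<Rightarrow> ('a \<times> 'a \<Rightarrow> real) \<Rightarrow>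
    ('a \<times> 'a \<Rightarrow> real) \<Rightarrow> ('a \<times> 'a \<times> 'a \<Rightarrow> real) \<Rightarrow>
    ('a \<times> 'a \<times> 'a \<Rightarrow> complex) \<Rightarrow> ('a \<times> 'a \<Rightarrow> complex)" where
  "delta1 E F \<alpha> r s \<psi> = (\<lambda>(x, y). if (x, y) \<in> E
     then 1 / of_real (r (x, y)) * (\<Sum>t\<in>face_set F x y.
            of_real (s (x, y, t)) * cis ((\<alpha> (t, x) + \<alpha> (t, y)) / 6) * \<psi> (x, y, t)) else 0)"

definition gauss_bonnet :: "'a set \<Rightarrow> ('a \<times> 'a) set \<Rightarrow> ('a \<times> 'a \<Rightarrow> real) \<Rightarrow> ('a \<times> 'a \<times> 'a) set \<Rightarrow>
    ('a \<Rightarrow> real) \<Rightarrow> ('a \<times> 'a \<Rightarrow> real) \<Rightarrow> ('a \<times> 'a \<times> 'a \<Rightarrow> real) \<Rightarrow> 'a triple \<Rightarrow> 'a triple" where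
  "gauss_bonnet V E \<alpha> F c r s = (\<lambda>(f, \<phi>, \<psi>).
     (delta0 V E \<alpha> c r \<phi>, (\<lambda>e. d0 E \<alpha> f e + delta1 E F \<alpha> r s \<psi> e), d1 F \<alpha> \<phi>))"

section \<open>Completeness\<close>

definition diff0 :: "('a \<Rightarrow> real) \<Rightarrow> 'a \<times> 'a \<Rightarrow> real" where
  "diff0 f = (\<lambda>(x, y). f y - f x)"

text \<open>
  The cut-off functions take values in \<open>[0, 1]\<close>, so they are taken real-valued.
\<close>

definition chi_complete :: "'a set \<Rightarrow> ('a \<times> 'a) set \<Rightarrow> ('a \<times> 'a \<times> 'a) set \<Rightarrow>
    ('a \<Rightarrow> real) \<Rightarrow> ('a \<times> 'a \<Rightarrow> real) \<Rightarrow> ('a \<times> 'a \<times> 'a \<Rightarrow> real) \<Rightarrow> bool" where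
  "chi_complete V E F c r s \<longleftrightarrow>
    (\<exists>C>0. \<exists>(B :: nat \<Rightarrow> 'a set) (h :: nat \<Rightarrow> 'a \<Rightarrow> real).
       incseq B \<and> (\<forall>n. finite (B n)) \<and> V = (\<Union>n. B n) \<and>
       (\<forall>n. finite {x \<in> V. h n x \<noteq> 0} \<and> (\<forall>x\<in>V. 0 \<le> h n x \<and> h n x \<le> 1) \<and>
            (\<forall>x\<in>B n. h n x = 1) \<and>
            (\<forall>x\<in>V. 1 / c x * (\<Sum>e\<in>{e \<in> E. snd e = x}. r e * \<bar>diff0 (h n) e\<bar>\<^sup>2) \<le> C) \<and>
            (\<forall>(x, y)\<in>E. 1 / r (x, y) * (\<Sum>t\<in>face_set F x y.
                s (x, y, t) * \<bar>diff0 (h n) (t, x) + diff0 (h n) (t, y)\<bar>\<^sup>2) \<le> C)))"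

end

(*
A symmetric operator is essentially self-adjoint as soon as its maximal extension G_max, the graph of
the formal operator T on those u for which u and T u are both in H, lies in the closure of the
operator on finitely supported elements: the adjoint is always contained in G_max, and G_max is then
symmetric, being a limit of a symmetric operator. To approximate (u, T u), multiply u by the cut-offs: chi_n on vertices,
(chi_n(x) + chi_n(y)) / 2 on edges, (chi_n(x) + chi_n(y) + chi_n(z)) / 3 on faces. With these averages
the commutator of T with the multiplication involves only the differences that chi-completeness
controls: on edges d0 chi_n / 2, and on faces
(d0 chi_n(z,x) + d0 chi_n(z,y)) / 6, the edge average minus the face average. By Cauchy-Schwarz on the
stars of vertices and on the sets F_xy, the commutators are bounded in H uniformly in n. They are
eventually zero on each finitely supported element, hence tend to zero strongly, so
T (chi_n u) = chi_n T u + [T, chi_n] u tends to T u.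
*)
theory Submission
  imports Defs
begin

section \<open>Weighted square-summable functions\<close>

text \<open>The obstacle is that T is unbounded: for u in l2 nothing is known about T u, so a
  commutator cannot be formed inside the Hilbert space. It is formed in the space of all triples,
  where local finiteness makes every operator sum finite, and only the commutator is bounded. For
  its strong convergence u is replaced by u - chi_k u with k fixed: for large n the commutator does
  not see chi_k u. The adjoint lies in G_max because Green's formula, with one finitely supported
  factor, holds against arbitrary triples, so T u - v can be tested against its own cut-off. The
  three components form one weighted l2 space over the disjoint union of vertices, edges and faces.
  Means serve as multipliers because they are invariant under permutations and so preserve skewness.
  The phases have modulus one and drop out of every estimate, which leaves non-magnetic differences.
  delta0 and delta1 are weighted sums over fibres (edges over their heads, faces over their first
  edge), d0 and d1 are built from pullbacks; both kinds of estimate use the fibre sums that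
  chi-completeness bounds.\<close>

text \<open>A bound on all finite partial sums expresses, for nonnegative weights, summability and
  an estimate of the squared norm at once, so estimates reduce to finite sums without side
  conditions.\<close>

definition l2_le :: "'p set \<Rightarrow> ('p \<Rightarrow> real) \<Rightarrow> ('p \<Rightarrow> complex) \<Rightarrow> real \<Rightarrow> bool" where
  "l2_le X w f B \<longleftrightarrow> (\<forall>A. finite A \<longrightarrow> A \<subseteq> X \<longrightarrow> (\<Sum>p\<in>A. w p * (cmod (f p))\<^sup>2) \<le> B)"

text \<open>The squared norm. Since \<open>infsum\<close> is 0 for families that are not summable,
  an upper bound on it is informative only next to \<open>l2_summable\<close>.\<close>

definition l2_sum :: "'p set \<Rightarrow> ('p \<Rightarrow> real) \<Rightarrow> ('p \<Rightarrow> complex) \<Rightarrow> real" where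
  "l2_sum X w f = (\<Sum>\<^sub>\<infinity>p\<in>X. w p * (cmod (f p))\<^sup>2)"

definition l2_summable :: "'p set \<Rightarrow> ('p \<Rightarrow> real) \<Rightarrow> ('p \<Rightarrow> complex) \<Rightarrow> bool" where
  "l2_summable X w f \<longleftrightarrow> (\<lambda>p. w p * (cmod (f p))\<^sup>2) summable_on X"

lemma l2_leD: "l2_le X w f B \<Longrightarrow> finite A \<Longrightarrow> A \<subseteq> X \<Longrightarrow> (\<Sum>p\<in>A. w p * (cmod (f p))\<^sup>2) \<le> B"
  by (simp add: l2_le_def)

lemma l2_le_nonneg: "l2_le X w f B \<Longrightarrow> 0 \<le> B"
  using l2_leD[of X w f B "{}"] by simp

lemma l2_le_mono: "l2_le X w f B \<Longrightarrow> B \<le> B' \<Longrightarrow> l2_le X w f B'"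
  by (force simp: l2_le_def)

lemma l2_summable_cong:
  "(\<And>p. p \<in> X \<Longrightarrow> f p = g p) \<Longrightarrow> l2_summable X w f \<longleftrightarrow> l2_summable X w g"
  unfolding l2_summable_def by (intro summable_on_cong) simp

lemma l2_sum_cong: "(\<And>p. p \<in> X \<Longrightarrow> f p = g p) \<Longrightarrow> l2_sum X w f = l2_sum X w g"
  unfolding l2_sum_def by (intro infsum_cong) simp

locale weight =
  fixes X :: "'p set" and w :: "'p \<Rightarrow> real"
  assumes w_pos: "p \<in> X \<Longrightarrow> 0 < w p"
begin

lemma w_nonneg: "p \<in> X \<Longrightarrow> 0 \<le> w p"
  using w_pos by (simp add: less_imp_le)

lemma l2_le_imp_summable:
  assumes "l2_le X w f B"
  shows "l2_summable X w f"
  unfolding l2_summable_def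
proof (rule nonneg_bdd_above_summable_on)
  show "bdd_above (sum (\<lambda>p. w p * (cmod (f p))\<^sup>2) ` {F. F \<subseteq> X \<and> finite F})"
    using l2_leD[OF assms] by (auto intro!: bdd_aboveI[of _ B])
qed (simp add: w_nonneg)

lemma l2_le_l2_sum: "l2_summable X w f \<Longrightarrow> l2_le X w f (l2_sum X w f)"
  unfolding l2_le_def l2_sum_def l2_summable_def
  by (auto intro!: finite_sum_le_infsum simp: w_nonneg)

lemma l2_sum_le: "l2_le X w f B \<Longrightarrow> l2_sum X w f \<le> B"
  using l2_le_imp_summable[of f B] unfolding l2_sum_def l2_summable_def
  by (intro infsum_le_finite_sums) (auto simp: l2_leD)

lemma l2_sum_nonneg: "0 \<le> l2_sum X w f"
  unfolding l2_sum_def by (intro infsum_nonneg) (simp add: w_nonneg)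

text \<open>Uses (a + b)^2 \<le> 2 a^2 + 2 b^2 in place of Minkowski, which keeps every estimate
  linear in squared norms. Pointwise domination as hypothesis covers sums and differences
  alike.\<close>

lemma l2_le_triangle:
  assumes "l2_le X w f B" "l2_le X w g B'" and le: "\<And>p. p \<in> X \<Longrightarrow> cmod (h p) \<le> cmod (f p) + cmod (g p)"
  shows "l2_le X w h (2 * B + 2 * B')"
  unfolding l2_le_def
proof (intro allI impI)
  fix A assume A: "finite A" "A \<subseteq> X"
  have *: "(cmod (h p))\<^sup>2 \<le> 2 * (cmod (f p))\<^sup>2 + 2 * (cmod (g p))\<^sup>2" if "p \<in> X" for p
  proof -
    have "(cmod (h p))\<^sup>2 \<le> (cmod (f p) + cmod (g p))\<^sup>2"
      using le[OF that] by (intro power_mono) auto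
    also have "\<dots> \<le> 2 * (cmod (f p))\<^sup>2 + 2 * (cmod (g p))\<^sup>2"
      using zero_le_power2[of "cmod (f p) - cmod (g p)"] by (simp add: power2_eq_square algebra_simps)
    finally show ?thesis .
  qed
  have "(\<Sum>p\<in>A. w p * (cmod (h p))\<^sup>2)
      \<le> (\<Sum>p\<in>A. w p * (2 * (cmod (f p))\<^sup>2 + 2 * (cmod (g p))\<^sup>2))"
    using A by (intro sum_mono mult_left_mono * w_nonneg) auto
  also have "\<dots> = 2 * (\<Sum>p\<in>A. w p * (cmod (f p))\<^sup>2) + 2 * (\<Sum>p\<in>A. w p * (cmod (g p))\<^sup>2)"
    by (simp add: algebra_simps sum.distrib sum_distrib_left)
  also have "\<dots> \<le> 2 * B + 2 * B'"
    using l2_leD[OF assms(1) A] l2_leD[OF assms(2) A] by simp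
  finally show "(\<Sum>p\<in>A. w p * (cmod (h p))\<^sup>2) \<le> 2 * B + 2 * B'" .
qed

lemma l2_le_diff:
  "l2_le X w f B \<Longrightarrow> l2_le X w g B' \<Longrightarrow> l2_le X w (\<lambda>p. f p - g p) (2 * B + 2 * B')"
  by (rule l2_le_triangle) (auto intro: norm_triangle_ineq4)

lemma l2_summable_diff:
  "l2_summable X w f \<Longrightarrow> l2_summable X w g \<Longrightarrow> l2_summable X w (\<lambda>p. f p - g p)"
  by (rule l2_le_imp_summable[OF l2_le_diff[OF l2_le_l2_sum l2_le_l2_sum]])

lemma l2_sum_diff_le:
  "l2_summable X w f \<Longrightarrow> l2_summable X w g \<Longrightarrow>
    l2_sum X w (\<lambda>p. f p - g p) \<le> 2 * l2_sum X w f + 2 * l2_sum X w g"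
  by (rule l2_sum_le[OF l2_le_diff[OF l2_le_l2_sum l2_le_l2_sum]])

lemma l2_summable_finite_support:
  "finite {p \<in> X. f p \<noteq> 0} \<Longrightarrow> l2_summable X w f"
  unfolding l2_summable_def
  by (rule finite_nonzero_values_imp_summable_on) (auto elim: rev_finite_subset)

text \<open>A uniform bound on finite sums of absolute values gives absolute summability, and with
  it both conclusions.\<close>

lemma l2_Cauchy_Schwarz:
  assumes "l2_summable X w f" "l2_summable X w g"
  shows "(\<lambda>p. of_real (w p) * f p * cnj (g p)) summable_on X"
    and "cmod (\<Sum>\<^sub>\<infinity>p\<in>X. of_real (w p) * f p * cnj (g p)) \<le> sqrt (l2_sum X w f) * sqrt (l2_sum X w g)"
proof -
  let ?k = "\<lambda>p. of_real (w p) * f p * cnj (g p)"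
  let ?B = "sqrt (l2_sum X w f) * sqrt (l2_sum X w g)"
  have fin: "(\<Sum>p\<in>A. cmod (?k p)) \<le> ?B" if A: "finite A" "A \<subseteq> X" for A
  proof -
    \<comment> \<open>Splitting the weight into two square roots reduces the claim to the unweighted
      Cauchy-Schwarz inequality on a finite set.\<close>
    let ?a = "\<lambda>f p. sqrt (w p) * cmod (f p)"
    have "(\<Sum>p\<in>A. cmod (?k p)) = (\<Sum>p\<in>A. \<bar>?a f p\<bar> * \<bar>?a g p\<bar>)"
    proof (rule sum.cong)
      fix p assume "p \<in> A"
      then have "0 \<le> w p" using A w_nonneg by auto
      then have "sqrt (w p) * sqrt (w p) = w p" by simp
      then have "w p * X = sqrt (w p) * (sqrt (w p) * X)" for X by (metis mult.assoc)
      then show "cmod (?k p) = \<bar>?a f p\<bar> * \<bar>?a g p\<bar>"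
        using \<open>0 \<le> w p\<close> by (simp add: norm_mult abs_mult ac_simps)
    qed simp
    also have "\<dots> \<le> L2_set (?a f) A * L2_set (?a g) A"
      by (rule L2_set_mult_ineq)
    also have "\<dots> \<le> ?B"
    proof -
      have "L2_set (?a h) A \<le> sqrt (l2_sum X w h)" if "l2_summable X w h" for h
      proof -
        have "(\<Sum>p\<in>A. (?a h p)\<^sup>2) = (\<Sum>p\<in>A. w p * (cmod (h p))\<^sup>2)"
          using A w_nonneg by (intro sum.cong) (auto simp: power_mult_distrib subset_iff)
        then show ?thesis
          unfolding L2_set_def using l2_leD[OF l2_le_l2_sum[OF that] A] by simp
      qed
      then show ?thesis
        using assms by (intro mult_mono) (auto simp: l2_sum_nonneg)
    qed
    finally show ?thesis .
  qed
  have abs: "(\<lambda>p. cmod (?k p)) summable_on X"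
  proof (rule nonneg_bdd_above_summable_on)
    show "bdd_above (sum (\<lambda>p. cmod (?k p)) ` {F. F \<subseteq> X \<and> finite F})"
      by (rule bdd_aboveI[of _ ?B]) (use fin in auto)
  qed simp
  show "?k summable_on X"
    using abs by (rule abs_summable_summable)
  have "cmod (\<Sum>\<^sub>\<infinity>p\<in>X. ?k p) \<le> (\<Sum>\<^sub>\<infinity>p\<in>X. cmod (?k p))"
    using abs by (rule norm_infsum_bound)
  also have "\<dots> \<le> ?B"
    using abs fin by (intro infsum_le_finite_sums) auto
  finally show "cmod (\<Sum>\<^sub>\<infinity>p\<in>X. ?k p) \<le> ?B" .
qed

text \<open>A quantitative form of dominated convergence: \<open>A\<close> carries all but
  \<open>e\<close> of the squared norm of \<open>f\<close>, so any function dominated by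
  \<open>f\<close> and vanishing on \<open>A\<close> is small.\<close>

lemma l2_tail:
  assumes f: "l2_summable X w f" and e: "0 < e"
  obtains A where "finite A" "A \<subseteq> X"
    and "\<And>g. (\<And>p. p \<in> A \<Longrightarrow> g p = 0) \<Longrightarrow> (\<And>p. p \<in> X \<Longrightarrow> cmod (g p) \<le> cmod (f p)) \<Longrightarrow>
      l2_le X w g e"
proof -
  let ?q = "\<lambda>p. w p * (cmod (f p))\<^sup>2"
  obtain A where A: "finite A" "A \<subseteq> X" "dist (sum ?q A) (l2_sum X w f) \<le> e"
    using infsum_finite_approximation[OF f[unfolded l2_summable_def] e] by (auto simp: l2_sum_def)
  show thesis
  proof (rule that[OF A(1,2)])
    fix g assume g0: "\<And>p. p \<in> A \<Longrightarrow> g p = 0" and gf: "\<And>p. p \<in> X \<Longrightarrow> cmod (g p) \<le> cmod (f p)"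
    show "l2_le X w g e"
      unfolding l2_le_def
    proof (intro allI impI)
      fix A' assume A': "finite A'" "A' \<subseteq> X"
      have "(\<Sum>p\<in>A'. w p * (cmod (g p))\<^sup>2) = (\<Sum>p\<in>A' - A. w p * (cmod (g p))\<^sup>2)"
        using A' g0 by (intro sum.mono_neutral_right) auto
      also have "\<dots> \<le> sum ?q (A' - A)"
        using A' gf by (intro sum_mono mult_left_mono power_mono w_nonneg) auto
      \<comment> \<open>Adding \<open>A\<close> back gives a difference whose first term is at most
        the total.\<close>
      also have "\<dots> = sum ?q (A' \<union> A) - sum ?q A"
      proof -
        have "(A' - A) \<inter> A = {}" "(A' - A) \<union> A = A' \<union> A" by auto
        then show ?thesis
          using A A' sum.union_disjoint[of "A' - A" A ?q] by simp
      qed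
      also have "\<dots> \<le> l2_sum X w f - sum ?q A"
        using l2_leD[OF l2_le_l2_sum[OF f], of "A' \<union> A"] A A' by simp
      also have "\<dots> \<le> e"
        using A(3) by (simp add: dist_real_def)
      finally show "(\<Sum>p\<in>A'. w p * (cmod (g p))\<^sup>2) \<le> e" .
    qed
  qed
qed

end

section \<open>Symmetric operators with cut-off functions\<close>

text \<open>
  Elements of the Hilbert space are given by their coordinates; \<open>S\<close> contains all elements
  satisfying the linear constraints, without any summability. The map \<open>T\<close> acts formally on \<open>S\<close>.
\<close>

locale cutoff_operator = weight X w for X :: "'p set" and w :: "'p \<Rightarrow> real" +
  fixes co :: "'h::minus \<Rightarrow> 'p \<Rightarrow> complex" and S D H :: "'h set" and ip :: "'h \<Rightarrow> 'h \<Rightarrow> complex"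
    and T :: "'h \<Rightarrow> 'h" and m :: "nat \<Rightarrow> 'p \<Rightarrow> real" and M :: "nat \<Rightarrow> 'h \<Rightarrow> 'h" and K :: real
  assumes co_diff: "p \<in> X \<Longrightarrow> co (u - v) p = co u p - co v p"
    and co_inj: "u \<in> S \<Longrightarrow> v \<in> S \<Longrightarrow> (\<And>p. p \<in> X \<Longrightarrow> co u p = co v p) \<Longrightarrow> u = v"
    and S_diff: "u \<in> S \<Longrightarrow> v \<in> S \<Longrightarrow> u - v \<in> S"
    and D_eq: "D = {u \<in> S. finite {p \<in> X. co u p \<noteq> 0}}"
    and H_eq: "H = {u \<in> S. l2_summable X w (co u)}"
    and ip_eq: "u \<in> H \<Longrightarrow> v \<in> H \<Longrightarrow> ip u v = (\<Sum>\<^sub>\<infinity>p\<in>X. of_real (w p) * co u p * cnj (co v p))"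
    and T_S: "u \<in> S \<Longrightarrow> T u \<in> S"
    and T_diff: "u \<in> S \<Longrightarrow> v \<in> S \<Longrightarrow> p \<in> X \<Longrightarrow> co (T (u - v)) p = co (T u) p - co (T v) p"
    and T_D: "u \<in> D \<Longrightarrow> T u \<in> D"
    and green: "u \<in> D \<Longrightarrow> v \<in> S \<Longrightarrow>
      (\<Sum>\<^sub>\<infinity>p\<in>X. of_real (w p) * co (T u) p * cnj (co v p)) =
      (\<Sum>\<^sub>\<infinity>p\<in>X. of_real (w p) * co u p * cnj (co (T v) p))"
    and m_finite: "finite {p \<in> X. m n p \<noteq> 0}"
    and m_range: "p \<in> X \<Longrightarrow> 0 \<le> m n p" "p \<in> X \<Longrightarrow> m n p \<le> 1"
    and m_eventually: "p \<in> X \<Longrightarrow> \<forall>\<^sub>F n in sequentially. m n p = 1"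
    and M_S: "u \<in> S \<Longrightarrow> M n u \<in> S"
    and co_M: "u \<in> S \<Longrightarrow> p \<in> X \<Longrightarrow> co (M n u) p = of_real (m n p) * co u p"
    and commutator_le: "u \<in> S \<Longrightarrow> l2_le X w (co u) B \<Longrightarrow>
      l2_le X w (\<lambda>p. co (T (M n u)) p - co (M n (T u)) p) (K * B)"
begin

abbreviation N2 :: "'h \<Rightarrow> real" where "N2 u \<equiv> l2_sum X w (co u)"

section \<open>The Hilbert space in coordinates\<close>

lemma D_subset_H: "D \<subseteq> H"
  unfolding D_eq H_eq by (auto intro: l2_summable_finite_support)

lemma H_subset_S: "H \<subseteq> S"
  unfolding H_eq by auto

lemma H_summable: "u \<in> H \<Longrightarrow> l2_summable X w (co u)"
  unfolding H_eq by auto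

lemma H_diff: "u \<in> H \<Longrightarrow> v \<in> H \<Longrightarrow> u - v \<in> H"
  unfolding H_eq
  by (auto simp: S_diff co_diff l2_summable_diff cong: l2_summable_cong)

lemma N2_diff_le: "u \<in> H \<Longrightarrow> v \<in> H \<Longrightarrow> N2 (u - v) \<le> 2 * N2 u + 2 * N2 v"
  using l2_sum_diff_le[OF H_summable H_summable, of u v]
  by (simp add: co_diff cong: l2_sum_cong)

lemma ip_norm_eq:
  assumes "u \<in> H"
  shows "ip_norm ip u = sqrt (N2 u)"
proof -
  have "ip u u = (\<Sum>\<^sub>\<infinity>p\<in>X. of_real (w p * (cmod (co u p))\<^sup>2))"
    unfolding ip_eq[OF assms assms]
    by (intro infsum_cong) (simp only: of_real_mult complex_norm_square mult.assoc)
  also have "\<dots> = of_real (N2 u)"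
    using H_summable[OF assms] unfolding l2_sum_def l2_summable_def
    by (intro infsumI) (simp only: has_sum_of_real_iff has_sum_infsum)
  finally show ?thesis by (simp add: ip_norm_def)
qed

lemma ip_norm_tendsto_iff:
  assumes "\<And>n. a n \<in> H" "u \<in> H"
  shows "(\<lambda>n. ip_norm ip (a n - u)) \<longlonglongrightarrow> 0 \<longleftrightarrow> (\<lambda>n. N2 (a n - u)) \<longlonglongrightarrow> 0"
proof -
  have eq: "ip_norm ip (a n - u) = sqrt (N2 (a n - u))" for n
    using assms by (simp add: ip_norm_eq H_diff)
  have sq: "N2 (a n - u) = (sqrt (N2 (a n - u)))\<^sup>2" for n
    by (simp add: l2_sum_nonneg)
  show ?thesis
  proof
    assume "(\<lambda>n. ip_norm ip (a n - u)) \<longlonglongrightarrow> 0"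
    then have "(\<lambda>n. (sqrt (N2 (a n - u)))\<^sup>2) \<longlonglongrightarrow> 0\<^sup>2"
      unfolding eq by (rule tendsto_power)
    then show "(\<lambda>n. N2 (a n - u)) \<longlonglongrightarrow> 0"
      using sq by simp
  next
    assume "(\<lambda>n. N2 (a n - u)) \<longlonglongrightarrow> 0"
    then show "(\<lambda>n. ip_norm ip (a n - u)) \<longlonglongrightarrow> 0"
      unfolding eq using tendsto_real_sqrt by fastforce
  qed
qed

lemma ip_cnj:
  assumes "u \<in> H" "v \<in> H"
  shows "ip u v = cnj (ip v u)"
  unfolding ip_eq[OF assms] ip_eq[OF assms(2,1)] infsum_cnj[symmetric]
  by (intro infsum_cong) (simp add: ac_simps)

lemma ip_diff_left:
  assumes "u \<in> H" "u' \<in> H" "v \<in> H"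
  shows "ip (u - u') v = ip u v - ip u' v"
proof -
  note s = l2_Cauchy_Schwarz(1)[OF H_summable H_summable]
  let ?k = "\<lambda>u p. of_real (w p) * co u p * cnj (co v p)"
  have "ip (u - u') v = (\<Sum>\<^sub>\<infinity>p\<in>X. ?k u p + - ?k u' p)"
    using assms by (simp add: ip_eq H_diff co_diff algebra_simps cong: infsum_cong)
  also have "\<dots> = ip u v - ip u' v"
    using assms s by (subst infsum_add) (simp_all add: ip_eq summable_on_uminus infsum_uminus)
  finally show ?thesis .
qed

lemma ip_bound: "u \<in> H \<Longrightarrow> v \<in> H \<Longrightarrow> cmod (ip u v) \<le> sqrt (N2 u) * sqrt (N2 v)"
  by (simp add: ip_eq l2_Cauchy_Schwarz(2) H_summable)

lemma ip_tendsto_left: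
  assumes a: "\<And>n. a n \<in> H" and u: "u \<in> H" and v: "v \<in> H"
    and lim: "(\<lambda>n. N2 (a n - u)) \<longlonglongrightarrow> 0"
  shows "(\<lambda>n. ip (a n) v) \<longlonglongrightarrow> ip u v"
proof -
  have "(\<lambda>n. sqrt (N2 (a n - u)) * sqrt (N2 v)) \<longlonglongrightarrow> sqrt 0 * sqrt (N2 v)"
    by (intro tendsto_intros lim)
  then have "(\<lambda>n. ip (a n) v - ip u v) \<longlonglongrightarrow> 0"
    using ip_bound[OF H_diff[OF a u] v] ip_diff_left[OF a u v]
    by (intro Lim_null_comparison[of "\<lambda>n. ip (a n) v - ip u v" "\<lambda>n. sqrt (N2 (a n - u)) * sqrt (N2 v)"])
       (auto intro!: always_eventually)
  then show ?thesis
    by (simp add: LIM_zero_iff)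
qed

lemma ip_tendsto_right:
  assumes a: "\<And>n. a n \<in> H" and u: "u \<in> H" and v: "v \<in> H"
    and lim: "(\<lambda>n. N2 (a n - u)) \<longlonglongrightarrow> 0"
  shows "(\<lambda>n. ip v (a n)) \<longlonglongrightarrow> ip v u"
  unfolding ip_cnj[OF v a] ip_cnj[OF v u]
  by (intro tendsto_cnj ip_tendsto_left assms)

section \<open>Strong convergence of the cut-offs\<close>

lemma M_D: "u \<in> S \<Longrightarrow> M n u \<in> D"
  unfolding D_eq using m_finite[of n] by (auto simp: M_S co_M elim!: rev_finite_subset)

text \<open>Only finitely many coordinates have to reach \<open>m n p = 1\<close>. The equality is
  exact, which later makes commutators vanish instead of merely becoming small.\<close>

lemma M_eventually_id:
  assumes "u \<in> D"
  shows "\<forall>\<^sub>F n in sequentially. M n u = u"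
proof -
  have u: "u \<in> S" and fin: "finite {p \<in> X. co u p \<noteq> 0}"
    using assms by (auto simp: D_eq)
  have "\<forall>\<^sub>F n in sequentially. \<forall>p\<in>{p \<in> X. co u p \<noteq> 0}. m n p = 1"
    using fin m_eventually by (intro eventually_ball_finite) auto
  then show ?thesis
  proof eventually_elim
    case (elim n)
    show ?case
      using elim by (intro co_inj) (auto simp: M_S u co_M)
  qed
qed

lemma M_tendsto:
  assumes "u \<in> H"
  shows "(\<lambda>n. N2 (M n u - u)) \<longlonglongrightarrow> 0"
proof (rule order_tendstoI)
  fix e :: real assume "e < 0"
  then show "\<forall>\<^sub>F n in sequentially. e < N2 (M n u - u)"
    by (intro always_eventually allI less_le_trans[OF _ l2_sum_nonneg])
next
  fix e :: real assume e: "0 < e"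
  have u: "u \<in> S" using assms H_subset_S by auto
  \<comment> \<open>The tail bound is not strict, hence \<open>e / 2\<close>.\<close>
  obtain A where A: "finite A" "A \<subseteq> X"
    and tail: "\<And>g. (\<And>p. p \<in> A \<Longrightarrow> g p = 0) \<Longrightarrow> (\<And>p. p \<in> X \<Longrightarrow> cmod (g p) \<le> cmod (co u p)) \<Longrightarrow>
      l2_le X w g (e / 2)"
    using l2_tail[OF H_summable[OF assms], of "e / 2"] e by auto
  have "\<forall>\<^sub>F n in sequentially. \<forall>p\<in>A. m n p = 1"
    using A m_eventually by (intro eventually_ball_finite) auto
  then show "\<forall>\<^sub>F n in sequentially. N2 (M n u - u) < e"
  proof eventually_elim
    case (elim n)
    have eq: "co (M n u - u) p = of_real (m n p - 1) * co u p" if "p \<in> X" for p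
      using that u by (simp add: co_diff co_M algebra_simps)
    have "l2_le X w (co (M n u - u)) (e / 2)"
    proof (rule tail)
      fix p assume "p \<in> A"
      then show "co (M n u - u) p = 0"
        using A elim eq by auto
    next
      fix p assume p: "p \<in> X"
      have "\<bar>m n p - 1\<bar> * cmod (co u p) \<le> 1 * cmod (co u p)"
        using m_range[OF p, of n] by (intro mult_right_mono) auto
      then show "cmod (co (M n u - u) p) \<le> cmod (co u p)"
        by (simp only: eq[OF p] norm_mult norm_of_real mult_1)
    qed
    then show ?case
      using l2_sum_le e by fastforce
  qed
qed

lemma dense_D: "dense_subset H ip D"
  unfolding dense_subset_def
proof (intro conjI ballI allI impI D_subset_H)
  fix u :: 'h and e :: real
  assume u: "u \<in> H" and e: "0 < e"
  have S: "u \<in> S" using u H_subset_S by auto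
  have "(\<lambda>n. ip_norm ip (M n u - u)) \<longlonglongrightarrow> 0"
    using M_tendsto[OF u] ip_norm_tendsto_iff[of "\<lambda>n. M n u" u] M_D[OF S] D_subset_H u by blast
  then have "\<forall>\<^sub>F n in sequentially. ip_norm ip (M n u - u) < e"
    using e by (rule order_tendstoD(2))
  then obtain n where "ip_norm ip (M n u - u) < e"
    by (auto simp: eventually_sequentially)
  then show "\<exists>v\<in>D. ip_norm ip (v - u) < e"
    using M_D[OF S] by auto
qed

text \<open>
  The commutators vanish eventually on \<open>D\<close> and are uniformly bounded, hence tend to zero strongly.
\<close>

lemma commutator_tendsto:
  assumes u: "u \<in> H"
  shows "(\<lambda>n. l2_sum X w (\<lambda>p. co (T (M n u)) p - co (M n (T u)) p)) \<longlonglongrightarrow> 0"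
proof (rule order_tendstoI)
  fix e :: real assume "e < 0"
  then show "\<forall>\<^sub>F n in sequentially. e < l2_sum X w (\<lambda>p. co (T (M n u)) p - co (M n (T u)) p)"
    by (intro always_eventually allI less_le_trans[OF _ l2_sum_nonneg])
next
  fix e :: real assume e: "0 < e"
  have S: "u \<in> S" using u H_subset_S by auto
  have "(\<lambda>n. K * N2 (u - M n u)) \<longlonglongrightarrow> K * 0"
  proof (intro tendsto_intros)
    have "N2 (u - M n u) = N2 (M n u - u)" for n
      unfolding l2_sum_def by (intro infsum_cong) (simp add: co_diff norm_minus_commute)
    then show "(\<lambda>n. N2 (u - M n u)) \<longlonglongrightarrow> 0"
      using M_tendsto[OF u] by simp
  qed
  then have "\<forall>\<^sub>F n in sequentially. K * N2 (u - M n u) < e"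
    using e by (intro order_tendstoD(2)) auto
  \<comment> \<open>From here on \<open>k\<close> is fixed while \<open>n\<close> grows.\<close>
  then obtain k where k: "K * N2 (u - M k u) < e"
    by (auto simp: eventually_sequentially)
  let ?v = "M k u"
  have vD: "?v \<in> D" using S by (rule M_D)
  then have vH: "?v \<in> H" and vS: "?v \<in> S" using D_subset_H H_subset_S by auto
  \<comment> \<open>The commutator on \<open>?v\<close> vanishes once \<open>M n\<close> fixes both
    \<open>?v\<close> and \<open>T ?v\<close>; the second needs that \<open>T\<close> preserves
    finite support.\<close>
  note ev = M_eventually_id[OF vD] M_eventually_id[OF T_D[OF vD]]
  from ev show "\<forall>\<^sub>F n in sequentially.
      l2_sum X w (\<lambda>p. co (T (M n u)) p - co (M n (T u)) p) < e"
  proof eventually_elim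
    case (elim n)
    have "co (T (M n (u - ?v))) p - co (M n (T (u - ?v))) p = co (T (M n u)) p - co (M n (T u)) p"
      if p: "p \<in> X" for p
    proof -
      \<comment> \<open>Additivity of \<open>M n\<close> on \<open>S\<close> is not an assumption;
        it follows from its coordinates.\<close>
      have "M n (u - ?v) = M n u - M n ?v"
        by (rule co_inj) (use S vS in \<open>simp_all add: M_S S_diff co_M co_diff algebra_simps\<close>)
      then have "co (T (M n (u - ?v))) p = co (T (M n u)) p - co (T ?v) p"
        using S vS p elim by (simp add: T_diff M_S)
      moreover have "co (M n (T (u - ?v))) p = co (M n (T u)) p - co (M n (T ?v)) p"
        using S vS p by (simp add: co_M T_S S_diff T_diff right_diff_distrib)
      ultimately show ?thesis
        using elim by simp
    qed
    then have "l2_sum X w (\<lambda>p. co (T (M n u)) p - co (M n (T u)) p)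
      = l2_sum X w (\<lambda>p. co (T (M n (u - ?v))) p - co (M n (T (u - ?v))) p)"
      by (intro l2_sum_cong) simp
    also have "\<dots> \<le> K * N2 (u - ?v)"
      by (intro l2_sum_le commutator_le l2_le_l2_sum H_summable H_diff u vH S_diff S vS)
    finally show ?case
      using k by simp
  qed
qed

section \<open>The maximal extension, its adjoint and the closure\<close>

definition max_graph :: "('h \<times> 'h) set" where
  "max_graph = {(u, v). u \<in> H \<and> v \<in> H \<and> v = T u}"

text \<open>The error is the commutator applied to \<open>u\<close> minus the cut-off error of
  \<open>T u\<close>. The second term is controlled by \<open>M_tendsto\<close> for
  \<open>T u\<close>, hence the hypothesis \<open>T u \<in> H\<close>.\<close>

lemma cutoff_tendsto_max:
  assumes u: "u \<in> H" and Tu: "T u \<in> H"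
  shows "(\<lambda>n. N2 (T (M n u) - T u)) \<longlonglongrightarrow> 0"
proof (rule tendsto_sandwich[OF always_eventually _ tendsto_const])
  let ?c = "\<lambda>n. l2_sum X w (\<lambda>p. co (T (M n u)) p - co (M n (T u)) p)"
  have S: "u \<in> S" using u H_subset_S by auto
  have TM: "T (M n u) \<in> H" and MT: "M n (T u) \<in> H" for n
    using S T_S M_D T_D D_subset_H by blast+
  show "\<forall>\<^sub>F n in sequentially. N2 (T (M n u) - T u) \<le> 2 * ?c n + 2 * N2 (T u - M n (T u))"
  proof (intro always_eventually allI)
    fix n
    have "N2 (T (M n u) - T u) = N2 ((T (M n u) - M n (T u)) - (T u - M n (T u)))"
      by (intro l2_sum_cong) (simp add: co_diff)
    also have "\<dots> \<le> 2 * N2 (T (M n u) - M n (T u)) + 2 * N2 (T u - M n (T u))"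
      by (intro N2_diff_le H_diff TM MT Tu)
    also have "N2 (T (M n u) - M n (T u)) = ?c n"
      by (intro l2_sum_cong) (simp add: co_diff)
    finally show "N2 (T (M n u) - T u) \<le> 2 * ?c n + 2 * N2 (T u - M n (T u))" .
  qed
  have sym: "N2 (T u - M n (T u)) = N2 (M n (T u) - T u)" for n
    unfolding l2_sum_def by (intro infsum_cong) (simp add: co_diff norm_minus_commute)
  have "(\<lambda>n. 2 * ?c n + 2 * N2 (M n (T u) - T u)) \<longlonglongrightarrow> 2 * 0 + 2 * 0"
    by (intro tendsto_intros commutator_tendsto M_tendsto u Tu)
  then show "(\<lambda>n. 2 * ?c n + 2 * N2 (T u - M n (T u))) \<longlonglongrightarrow> 0"
    by (simp add: sym)
qed (simp add: l2_sum_nonneg)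

text \<open>Green's formula needs finite support on one side only; the memberships in
  \<open>H\<close> allow both sums to be read as inner products.\<close>

lemma symmetric_D:
  assumes "x \<in> D" "u \<in> H" "T u \<in> H"
  shows "ip (T x) u = ip x (T u)"
proof -
  have "T x \<in> H" "x \<in> H" "u \<in> S" using assms T_D D_subset_H H_subset_S by auto
  then show ?thesis using assms green by (simp add: ip_eq)
qed

text \<open>One sequence has two limits: directly by convergence of \<open>T (M n x)\<close>, and,
  after moving \<open>T\<close> onto \<open>u\<close> for each n, by convergence of
  \<open>M n x\<close>.\<close>

lemma max_graph_symmetric:
  assumes x: "x \<in> H" "T x \<in> H" and u: "u \<in> H" "T u \<in> H"
  shows "ip (T x) u = ip x (T u)"
proof (rule LIMSEQ_unique)
  have S: "x \<in> S" using x H_subset_S by auto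
  have M: "M n x \<in> D" for n using S by (rule M_D)
  then have MH: "M n x \<in> H" "T (M n x) \<in> H" for n using T_D D_subset_H by blast+
  show "(\<lambda>n. ip (T (M n x)) u) \<longlonglongrightarrow> ip (T x) u"
    by (intro ip_tendsto_left MH x u cutoff_tendsto_max)
  show "(\<lambda>n. ip (T (M n x)) u) \<longlonglongrightarrow> ip x (T u)"
    unfolding symmetric_D[OF M u]
    by (intro ip_tendsto_left MH x u M_tendsto)
qed

text \<open>The defect z = T u - v is orthogonal to all of \<open>D\<close> in the formal pairing.
  It need not be square-summable, so it is tested against its cut-off \<open>M n z\<close>, which
  lies in \<open>D\<close>; the result is a vanishing sum of nonnegative terms.\<close>

lemma adjoint_subset_max: "adjoint_graph H ip (op_graph D T) \<subseteq> max_graph"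
proof (clarify)
  fix u v assume "(u, v) \<in> adjoint_graph H ip (op_graph D T)"
  then have u: "u \<in> H" and v: "v \<in> H" and adj: "\<And>x. x \<in> D \<Longrightarrow> ip (T x) u = ip x v"
    by (auto simp: adjoint_graph_def op_graph_def)
  have S: "u \<in> S" "T u \<in> S" "v \<in> S" using u v H_subset_S T_S by auto
  define z where "z = T u - v"
  have zS: "z \<in> S" unfolding z_def using S by (intro S_diff)
  have "co z p = 0" if p: "p \<in> X" for p
  proof -
    have "\<forall>\<^sub>F n in sequentially. m n p = 1" using p by (rule m_eventually)
    \<comment> \<open>The index may depend on \<open>p\<close>, since coordinates are shown to
      vanish one at a time.\<close>
    then obtain n where n: "m n p = 1" by (auto simp: eventually_sequentially)
    let ?x = "M n z" and ?A = "{p \<in> X. m n p \<noteq> 0}"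
    have xD: "?x \<in> D" using zS by (rule M_D)
    then have xH: "?x \<in> H" "T ?x \<in> H" using T_D D_subset_H by auto
    let ?i = "\<lambda>y. \<Sum>p\<in>?A. of_real (w p) * co ?x p * cnj (co y p)"
    \<comment> \<open>The support of \<open>m n\<close> makes the pairing a finite sum, hence
      additive in \<open>y\<close> even for \<open>y\<close> outside \<open>H\<close>.\<close>
    have fin: "(\<Sum>\<^sub>\<infinity>p\<in>X. of_real (w p) * co ?x p * cnj (co y p)) = ?i y" for y
    proof -
      have "(\<Sum>\<^sub>\<infinity>p\<in>X. of_real (w p) * co ?x p * cnj (co y p))
          = (\<Sum>\<^sub>\<infinity>p\<in>?A. of_real (w p) * co ?x p * cnj (co y p))"
        by (rule infsum_cong_neutral) (auto simp: co_M zS)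
      then show ?thesis using m_finite by simp
    qed
    have "?i (T u) = ?i v"
      \<comment> \<open>The same pairing of \<open>T ?x\<close> with \<open>u\<close> is evaluated
        twice: formally through \<open>green\<close> and through the adjoint relation.\<close>
      using adj[OF xD] green[OF xD S(1)] xH u v by (simp add: ip_eq fin)
    then have "?i z = 0"
      by (simp add: z_def co_diff algebra_simps sum_subtractf)
    also have "?i z = of_real (\<Sum>p\<in>?A. w p * m n p * (cmod (co z p))\<^sup>2)"
      by (simp only: of_real_sum of_real_mult complex_norm_square mult.assoc)
         (simp add: co_M zS mult.assoc)
    finally have "(\<Sum>p\<in>?A. w p * m n p * (cmod (co z p))\<^sup>2) = 0"
      by (simp only: of_real_eq_0_iff)
    then have "\<forall>p\<in>?A. w p * m n p * (cmod (co z p))\<^sup>2 = 0"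
      using m_finite m_range w_nonneg by (subst (asm) sum_nonneg_eq_0_iff) auto
    then have "w p * m n p * (cmod (co z p))\<^sup>2 = 0"
      using n p by auto
    then show ?thesis
      using n w_pos[OF p] by simp
  qed
  then have "T u = v"
    using S by (intro co_inj) (auto simp: z_def co_diff)
  then show "(u, v) \<in> max_graph"
    using u v by (simp add: max_graph_def)
qed

text \<open>By symmetry and continuity of the inner product the closure lies in the adjoint, hence
  in \<open>max_graph\<close>; conversely the cut-offs \<open>M n u\<close> converge together with
  their images.\<close>

lemma closure_eq_max: "closure_graph H ip (op_graph D T) = max_graph"
proof (intro equalityI subrelI)
  fix u v assume "(u, v) \<in> closure_graph H ip (op_graph D T)"
  then obtain a b where u: "u \<in> H" and v: "v \<in> H" and g: "\<And>n. (a n, b n) \<in> op_graph D T"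
    and lim: "(\<lambda>n. ip_norm ip (a n - u)) \<longlonglongrightarrow> 0" "(\<lambda>n. ip_norm ip (b n - v)) \<longlonglongrightarrow> 0"
    by (auto simp: closure_graph_def)
  have a: "a n \<in> D" and b: "b n = T (a n)" for n using g[of n] by (auto simp: op_graph_def)
  then have aH: "a n \<in> H" and bH: "b n \<in> H" for n using T_D D_subset_H by auto
  have "ip (T x) u = ip x v" if x: "x \<in> D" for x
  proof (rule LIMSEQ_unique)
    have xH: "x \<in> H" "T x \<in> H" using x T_D D_subset_H by auto
    show "(\<lambda>n. ip (T x) (a n)) \<longlonglongrightarrow> ip (T x) u"
      using lim(1) by (intro ip_tendsto_right aH u xH) (simp add: ip_norm_tendsto_iff aH u)
    have "ip (T x) (a n) = ip x (b n)" for n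
      unfolding b by (rule symmetric_D[OF x aH]) (use bH b in simp)
    then show "(\<lambda>n. ip (T x) (a n)) \<longlonglongrightarrow> ip x v"
      using lim(2) by (simp, intro ip_tendsto_right bH v xH) (simp add: ip_norm_tendsto_iff bH v)
  qed
  then have "(u, v) \<in> adjoint_graph H ip (op_graph D T)"
    using u v by (auto simp: adjoint_graph_def op_graph_def)
  then show "(u, v) \<in> max_graph" using adjoint_subset_max by auto
next
  fix u v assume "(u, v) \<in> max_graph"
  then have u: "u \<in> H" and Tu: "T u \<in> H" and v: "v = T u" by (auto simp: max_graph_def)
  have "u \<in> S" using u H_subset_S by auto
  then have M: "M n u \<in> D" "M n u \<in> H" "T (M n u) \<in> H" for n using M_D T_D D_subset_H by blast+
  have "(\<lambda>n. ip_norm ip (M n u - u)) \<longlonglongrightarrow> 0"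
    by (subst ip_norm_tendsto_iff) (use M u M_tendsto in auto)
  moreover have "(\<lambda>n. ip_norm ip (T (M n u) - T u)) \<longlonglongrightarrow> 0"
    by (subst ip_norm_tendsto_iff) (use M u Tu cutoff_tendsto_max in auto)
  ultimately show "(u, v) \<in> closure_graph H ip (op_graph D T)"
    unfolding closure_graph_def v mem_Collect_eq case_prod_conv using u Tu M
    by (intro conjI SigmaI exI[of _ "\<lambda>n. M n u"] exI[of _ "\<lambda>n. T (M n u)"])
      (auto simp: op_graph_def)
qed

theorem essentially_selfadjoint_cutoff: "essentially_selfadjoint H ip D T"
  unfolding essentially_selfadjoint_def selfadjoint_graph_def closure_eq_max
proof (intro conjI dense_D ballI)
  show "T ` D \<subseteq> H" using T_D D_subset_H by auto
  show "ip (T u) v = ip u (T v)" if "u \<in> D" "v \<in> D" for u v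
    using that T_D D_subset_H by (intro symmetric_D) auto
  show "single_valued max_graph" by (auto simp: single_valued_def max_graph_def)
  have "D \<subseteq> Domain max_graph"
    using T_D D_subset_H by (auto simp: max_graph_def Domain_iff)
  moreover have "Domain max_graph \<subseteq> H" by (auto simp: max_graph_def)
  ultimately show "dense_subset H ip (Domain max_graph)"
    using dense_D unfolding dense_subset_def by (meson subset_iff)
  show "adjoint_graph H ip max_graph = max_graph"
  proof
    \<comment> \<open>Passing to adjoints reverses this inclusion, so the adjoint of
      \<open>max_graph\<close> lies in the adjoint of the minimal operator, which is already inside
      \<open>max_graph\<close>.\<close>
    have "op_graph D T \<subseteq> max_graph"
      using T_D D_subset_H by (auto simp: op_graph_def max_graph_def)
    then have "adjoint_graph H ip max_graph \<subseteq> adjoint_graph H ip (op_graph D T)"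
      by (auto simp: adjoint_graph_def)
    then show "adjoint_graph H ip max_graph \<subseteq> max_graph" using adjoint_subset_max by auto
    show "max_graph \<subseteq> adjoint_graph H ip max_graph"
      using max_graph_symmetric by (auto simp: adjoint_graph_def max_graph_def)
  qed
qed

end

section \<open>Fibrewise estimates and sums\<close>

text \<open>Trades the factors 1/2 and 1/6 of the inner products, once absorbed into the weights,
  for factors in the bound.\<close>

lemma l2_le_scale:
  assumes "0 < k"
  shows "l2_le X (\<lambda>p. w p / k) f B \<longleftrightarrow> l2_le X w f (k * B)"
proof -
  have "(\<Sum>p\<in>A. w p / k * (cmod (f p))\<^sup>2) = (\<Sum>p\<in>A. w p * (cmod (f p))\<^sup>2) / k" for A
    by (simp add: sum_divide_distrib)
  then show ?thesis
    using assms by (simp add: l2_le_def divide_le_eq mult.commute)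
qed

text \<open>Serves to transport estimates along edge reversal and face rotation.\<close>

lemma l2_le_reindex:
  assumes f: "l2_le X w f B" and \<sigma>: "inj_on \<sigma> X" "\<sigma> ` X \<subseteq> X"
    and w: "\<And>p. p \<in> X \<Longrightarrow> w (\<sigma> p) = w p"
  shows "l2_le X w (\<lambda>p. f (\<sigma> p)) B"
  unfolding l2_le_def
proof (intro allI impI)
  fix A assume A: "finite A" "A \<subseteq> X"
  have "(\<Sum>p\<in>A. w p * (cmod (f (\<sigma> p)))\<^sup>2) = (\<Sum>p\<in>\<sigma> ` A. w p * (cmod (f p))\<^sup>2)"
    using A w inj_on_subset[OF \<sigma>(1) A(2)] by (subst sum.reindex) (auto intro!: sum.cong)
  also have "\<dots> \<le> B"
    using A \<sigma> by (intro l2_leD[OF f]) auto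
  finally show "(\<Sum>p\<in>A. w p * (cmod (f (\<sigma> p)))\<^sup>2) \<le> B" .
qed

lemma norm_weighted_sum_le:
  assumes "0 < a"
  shows "cmod (1 / of_real a * sum g A) \<le> 1 / a * (\<Sum>y\<in>A. cmod (g y))"
  using assms by (simp add: norm_divide divide_right_mono norm_sum)

text \<open>Common frame for edges over their heads and faces over their first edge, so that each
  estimate and each fibre summation is proved once for both levels.\<close>

locale weighted_fibration = Y: weight Y wY + Z: weight Z wZ
  for Y :: "'y set" and wY :: "'y \<Rightarrow> real" and Z :: "'z set" and wZ :: "'z \<Rightarrow> real" +
  fixes \<pi> :: "'y \<Rightarrow> 'z"
  assumes \<pi>: "y \<in> Y \<Longrightarrow> \<pi> y \<in> Z"
    and finite_fibre: "z \<in> Z \<Longrightarrow> finite {y \<in> Y. \<pi> y = z}"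
begin

lemma infsum_fibres:
  fixes k :: "'y \<Rightarrow> complex"
  assumes fin: "finite {y \<in> Y. k y \<noteq> 0}"
  shows "(\<Sum>\<^sub>\<infinity>z\<in>Z. \<Sum>y\<in>{y \<in> Y. \<pi> y = z}. k y) = (\<Sum>\<^sub>\<infinity>y\<in>Y. k y)"
proof -
  let ?A = "{y \<in> Y. k y \<noteq> 0}"
  have eq: "(\<Sum>y\<in>{y \<in> Y. \<pi> y = z}. k y) = (\<Sum>y\<in>{y \<in> ?A. \<pi> y = z}. k y)" if "z \<in> Z" for z
    using finite_fibre[OF that] by (intro sum.mono_neutral_right) auto
  have "(\<Sum>\<^sub>\<infinity>z\<in>Z. \<Sum>y\<in>{y \<in> Y. \<pi> y = z}. k y) = (\<Sum>\<^sub>\<infinity>z\<in>\<pi> ` ?A. \<Sum>y\<in>{y \<in> ?A. \<pi> y = z}. k y)"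
  proof (rule infsum_cong_neutral)
    fix z assume z: "z \<in> Z - \<pi> ` ?A"
    then have empty: "{y \<in> ?A. \<pi> y = z} = {}" and "z \<in> Z" by auto
    then show "(\<Sum>y\<in>{y \<in> Y. \<pi> y = z}. k y) = 0"
      by (simp only: eq empty sum.empty)
  qed (use eq \<pi> in auto)
  also have "\<dots> = (\<Sum>z\<in>\<pi> ` ?A. \<Sum>y\<in>{y \<in> ?A. \<pi> y = z}. k y)"
    using fin by (intro infsum_finite) auto
  also have "\<dots> = sum k ?A"
    by (rule sum.image_gen[OF fin, symmetric])
  also have "\<dots> = (\<Sum>\<^sub>\<infinity>y\<in>?A. k y)"
    using fin by simp
  also have "\<dots> = (\<Sum>\<^sub>\<infinity>y\<in>Y. k y)"
    by (rule infsum_cong_neutral) auto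
  finally show ?thesis .
qed

text \<open>Cauchy-Schwarz on each fibre separates \<open>g\<close> from \<open>u\<close>; the fibre
  sum of \<open>g\<close> is bounded by \<open>C\<close> after normalisation, and the fibre sums of
  \<open>u\<close> add up to at most \<open>B\<close> because fibres are disjoint.\<close>

lemma l2_le_pushforward:
  assumes u: "l2_le Y wY u B"
    and g: "\<And>z. z \<in> Z \<Longrightarrow> 1 / wZ z * (\<Sum>y\<in>{y \<in> Y. \<pi> y = z}. wY y * (g y)\<^sup>2) \<le> C"
    and C: "0 \<le> C"
    and b: "\<And>z. z \<in> Z \<Longrightarrow>
      cmod (b z) \<le> 1 / wZ z * (\<Sum>y\<in>{y \<in> Y. \<pi> y = z}. wY y * (\<bar>g y\<bar> * cmod (u y)))"
  shows "l2_le Z wZ b (C * B)"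
  unfolding l2_le_def
proof (intro allI impI)
  fix A assume A: "finite A" "A \<subseteq> Z"
  let ?f = "\<lambda>z. {y \<in> Y. \<pi> y = z}"
  have pt: "wZ z * (cmod (b z))\<^sup>2 \<le> C * (\<Sum>y\<in>?f z. wY y * (cmod (u y))\<^sup>2)" if z: "z \<in> Z" for z
  proof -
    let ?S = "\<Sum>y\<in>?f z. wY y * (\<bar>g y\<bar> * cmod (u y))"
    have "?S\<^sup>2 = (\<Sum>y\<in>?f z. (sqrt (wY y) * \<bar>g y\<bar>) * (sqrt (wY y) * cmod (u y)))\<^sup>2"
      using Y.w_nonneg by (intro arg_cong[of _ _ "\<lambda>x. x\<^sup>2"] sum.cong) auto
    also have "\<dots> \<le> (\<Sum>y\<in>?f z. (sqrt (wY y) * \<bar>g y\<bar>)\<^sup>2) * (\<Sum>y\<in>?f z. (sqrt (wY y) * cmod (u y))\<^sup>2)"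
      by (rule Cauchy_Schwarz_ineq_sum)
    also have "\<dots> = (\<Sum>y\<in>?f z. wY y * (g y)\<^sup>2) * (\<Sum>y\<in>?f z. wY y * (cmod (u y))\<^sup>2)"
      using Y.w_nonneg by (intro arg_cong2[of _ _ _ _ times] sum.cong) (auto simp: power_mult_distrib)
    finally have S: "?S\<^sup>2 \<le> (\<Sum>y\<in>?f z. wY y * (g y)\<^sup>2) * (\<Sum>y\<in>?f z. wY y * (cmod (u y))\<^sup>2)" .
    have wz: "0 < wZ z" using z by (rule Z.w_pos)
    have "wZ z * (cmod (b z))\<^sup>2 \<le> wZ z * (1 / wZ z * ?S)\<^sup>2"
      using b[OF z] wz by (intro mult_left_mono power_mono) auto
    \<comment> \<open>One of the two factors \<open>1 / wZ z\<close> cancels against the weight; the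
      other is the normalisation in the hypothesis on \<open>g\<close>.\<close>
    also have "\<dots> = 1 / wZ z * ?S\<^sup>2"
      using wz by (simp add: power2_eq_square field_simps)
    also have "\<dots> \<le> 1 / wZ z * ((\<Sum>y\<in>?f z. wY y * (g y)\<^sup>2) * (\<Sum>y\<in>?f z. wY y * (cmod (u y))\<^sup>2))"
      using S wz by (intro mult_left_mono) auto
    also have "\<dots> = (1 / wZ z * (\<Sum>y\<in>?f z. wY y * (g y)\<^sup>2)) * (\<Sum>y\<in>?f z. wY y * (cmod (u y))\<^sup>2)"
      by (simp only: mult.assoc)
    also have "\<dots> \<le> C * (\<Sum>y\<in>?f z. wY y * (cmod (u y))\<^sup>2)"
      using g[OF z] Y.w_nonneg by (intro mult_right_mono sum_nonneg) auto
    finally show ?thesis .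
  qed
  have "(\<Sum>z\<in>A. wZ z * (cmod (b z))\<^sup>2) \<le> (\<Sum>z\<in>A. C * (\<Sum>y\<in>?f z. wY y * (cmod (u y))\<^sup>2))"
    using A pt by (intro sum_mono) auto
  also have "\<dots> = C * (\<Sum>z\<in>A. \<Sum>y\<in>?f z. wY y * (cmod (u y))\<^sup>2)"
    by (simp add: sum_distrib_left)
  also have "(\<Sum>z\<in>A. \<Sum>y\<in>?f z. wY y * (cmod (u y))\<^sup>2) = (\<Sum>y\<in>(\<Union>z\<in>A. ?f z). wY y * (cmod (u y))\<^sup>2)"
    using A finite_fibre by (intro sum.UNION_disjoint[symmetric]) auto
  also have "C * \<dots> \<le> C * B"
    using A finite_fibre C by (intro mult_left_mono l2_leD[OF u]) auto
  finally show "(\<Sum>z\<in>A. wZ z * (cmod (b z))\<^sup>2) \<le> C * B" .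
qed

text \<open>Here \<open>u\<close> is constant along each fibre, so it factors out and the fibre sum
  of \<open>g\<close> is bounded without Cauchy-Schwarz.\<close>

lemma l2_le_pullback:
  assumes u: "l2_le Z wZ u B"
    and g: "\<And>z. z \<in> Z \<Longrightarrow> 1 / wZ z * (\<Sum>y\<in>{y \<in> Y. \<pi> y = z}. wY y * (g y)\<^sup>2) \<le> C"
    and C: "0 \<le> C"
    and b: "\<And>y. y \<in> Y \<Longrightarrow> cmod (b y) \<le> \<bar>g y\<bar> * cmod (u (\<pi> y))"
  shows "l2_le Y wY b (C * B)"
  unfolding l2_le_def
proof (intro allI impI)
  fix A assume A: "finite A" "A \<subseteq> Y"
  let ?q = "\<lambda>y. wY y * ((g y)\<^sup>2 * (cmod (u (\<pi> y)))\<^sup>2)"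
  have "(\<Sum>y\<in>A. wY y * (cmod (b y))\<^sup>2) \<le> sum ?q A"
  proof (intro sum_mono mult_left_mono)
    fix y assume "y \<in> A"
    then have "(cmod (b y))\<^sup>2 \<le> (\<bar>g y\<bar> * cmod (u (\<pi> y)))\<^sup>2"
      using A b by (intro power_mono) auto
    then show "(cmod (b y))\<^sup>2 \<le> (g y)\<^sup>2 * (cmod (u (\<pi> y)))\<^sup>2"
      by (simp add: power_mult_distrib)
  qed (use A Y.w_nonneg in auto)
  also have "\<dots> = (\<Sum>z\<in>\<pi> ` A. \<Sum>y\<in>{y \<in> A. \<pi> y = z}. ?q y)"
    using A(1) by (rule sum.image_gen)
  also have "\<dots> \<le> (\<Sum>z\<in>\<pi> ` A. C * (wZ z * (cmod (u z))\<^sup>2))"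
  proof (rule sum_mono)
    fix z assume "z \<in> \<pi> ` A"
    then have z: "z \<in> Z" using A \<pi> by auto
    \<comment> \<open>The hypothesis on \<open>g\<close> concerns whole fibres, so the part inside
      \<open>A\<close> is enlarged to the full fibre.\<close>
    have "(\<Sum>y\<in>{y \<in> A. \<pi> y = z}. ?q y) \<le> (\<Sum>y\<in>{y \<in> Y. \<pi> y = z}. ?q y)"
      using A finite_fibre[OF z] Y.w_nonneg by (intro sum_mono2) auto
    also have "\<dots> = (\<Sum>y\<in>{y \<in> Y. \<pi> y = z}. wY y * (g y)\<^sup>2) * (cmod (u z))\<^sup>2"
      by (simp add: sum_distrib_right mult.assoc)
    also have "\<dots> \<le> (C * wZ z) * (cmod (u z))\<^sup>2"
      using g[OF z] Z.w_pos[OF z] by (intro mult_right_mono) (auto simp: field_simps)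
    finally show "(\<Sum>y\<in>{y \<in> A. \<pi> y = z}. ?q y) \<le> C * (wZ z * (cmod (u z))\<^sup>2)"
      by (simp only: mult.assoc)
  qed
  also have "\<dots> = C * (\<Sum>z\<in>\<pi> ` A. wZ z * (cmod (u z))\<^sup>2)"
    by (simp add: sum_distrib_left)
  also have "\<dots> \<le> C * B"
    using A \<pi> C by (intro mult_left_mono l2_leD[OF u]) auto
  finally show "(\<Sum>y\<in>A. wY y * (cmod (b y))\<^sup>2) \<le> C * B" .
qed

end

section \<open>Sums over disjoint unions\<close>

lemma summable_on_Plus_iff:
  fixes k :: "'a + 'b \<Rightarrow> 'c::{topological_comm_monoid_add, banach}"
  shows "k summable_on (A <+> B) \<longleftrightarrow> (\<lambda>a. k (Inl a)) summable_on A \<and> (\<lambda>b. k (Inr b)) summable_on B"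
proof -
  have "k summable_on (A <+> B) \<longleftrightarrow> k summable_on (Inl ` A) \<and> k summable_on (Inr ` B)"
  proof
    assume "k summable_on (A <+> B)"
    then show "k summable_on (Inl ` A) \<and> k summable_on (Inr ` B)"
      by (auto elim!: summable_on_subset_banach simp: Plus_def)
  qed (auto simp: Plus_def intro!: summable_on_Un_disjoint)
  then show ?thesis
    by (simp add: summable_on_reindex o_def)
qed

lemma infsum_Plus:
  fixes k :: "'a + 'b \<Rightarrow> 'c::banach"
  assumes "(\<lambda>a. k (Inl a)) summable_on A" "(\<lambda>b. k (Inr b)) summable_on B"
  shows "infsum k (A <+> B) = (\<Sum>\<^sub>\<infinity>a\<in>A. k (Inl a)) + (\<Sum>\<^sub>\<infinity>b\<in>B. k (Inr b))"
proof -
  have "infsum k (A <+> B) = infsum k (Inl ` A) + infsum k (Inr ` B)"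
    unfolding Plus_def using assms
    by (intro infsum_Un_disjoint) (auto simp: summable_on_reindex o_def)
  then show ?thesis
    by (simp add: infsum_reindex o_def)
qed

lemma l2_le_Plus:
  assumes "l2_le A v (\<lambda>a. f (Inl a)) C" "l2_le B w (\<lambda>b. f (Inr b)) C'"
  shows "l2_le (A <+> B) (case_sum v w) f (C + C')"
  unfolding l2_le_def
proof (intro allI impI)
  fix S assume S: "finite S" "S \<subseteq> A <+> B"
  let ?q = "\<lambda>p. case_sum v w p * (cmod (f p))\<^sup>2"
  have eq: "S = (Inl -` S) <+> (Inr -` S)"
  proof (rule set_eqI)
    show "p \<in> S \<longleftrightarrow> p \<in> (Inl -` S) <+> (Inr -` S)" for p by (cases p) auto
  qed
  have fin: "finite (Inl -` S)" "finite (Inr -` S)"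
    using S by (auto intro!: finite_vimageI)
  have "sum ?q S = sum ?q ((Inl -` S) <+> (Inr -` S))"
    using eq by simp
  also have "\<dots> = (\<Sum>a\<in>Inl -` S. v a * (cmod (f (Inl a)))\<^sup>2) + (\<Sum>b\<in>Inr -` S. w b * (cmod (f (Inr b)))\<^sup>2)"
    using fin by (subst sum.Plus) (simp_all add: o_def)
  also have "\<dots> \<le> C + C'"
    using S fin by (intro add_mono l2_leD[OF assms(1)] l2_leD[OF assms(2)]) auto
  finally show "sum ?q S \<le> C + C'" .
qed

lemma l2_le_PlusD:
  assumes "l2_le (A <+> B) (case_sum v w) f C"
  shows "l2_le A v (\<lambda>a. f (Inl a)) C" "l2_le B w (\<lambda>b. f (Inr b)) C"
  unfolding l2_le_def
proof (safe)
  fix S assume S: "finite S" "S \<subseteq> A"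
  then show "(\<Sum>a\<in>S. v a * (cmod (f (Inl a)))\<^sup>2) \<le> C"
    using l2_leD[OF assms, of "Inl ` S"] by (auto simp: sum.reindex)
next
  fix S assume S: "finite S" "S \<subseteq> B"
  then show "(\<Sum>b\<in>S. w b * (cmod (f (Inr b)))\<^sup>2) \<le> C"
    using l2_leD[OF assms, of "Inr ` S"] by (auto simp: sum.reindex)
qed

section \<open>Cut-offs on a weighted triangulation\<close>

text \<open>The fibre over an edge \<open>(x, y)\<close> is a copy of
  \<open>face_set F x y\<close>.\<close>

definition face_edge :: "'a \<times> 'a \<times> 'a \<Rightarrow> 'a \<times> 'a" where
  "face_edge = (\<lambda>(x, y, z). (x, y))"

definition rotate_face :: "'a \<times> 'a \<times> 'a \<Rightarrow> 'a \<times> 'a \<times> 'a" where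
  "rotate_face = (\<lambda>(x, y, z). (y, z, x))"

definition edge_mean :: "('a \<Rightarrow> real) \<Rightarrow> 'a \<times> 'a \<Rightarrow> real" where
  "edge_mean h = (\<lambda>(x, y). (h x + h y) / 2)"

definition face_mean :: "('a \<Rightarrow> real) \<Rightarrow> 'a \<times> 'a \<times> 'a \<Rightarrow> real" where
  "face_mean h = (\<lambda>(x, y, z). (h x + h y + h z) / 3)"

text \<open>The phase of \<open>delta1\<close>; those of \<open>d1\<close> are its conjugates at the
  three rotations of a face.\<close>

definition face_phase :: "('a \<times> 'a \<Rightarrow> real) \<Rightarrow> 'a \<times> 'a \<times> 'a \<Rightarrow> complex" where
  "face_phase \<alpha> = (\<lambda>(x, y, t). cis ((\<alpha> (t, x) + \<alpha> (t, y)) / 6))"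

text \<open>Six times the difference between the mean over the first edge and the mean over the
  face.\<close>

definition face_diff :: "('a \<Rightarrow> real) \<Rightarrow> 'a \<times> 'a \<times> 'a \<Rightarrow> real" where
  "face_diff h = (\<lambda>(x, y, t). diff0 h (t, x) + diff0 h (t, y))"

lemma (in weighted_fibration) finite_vimage_fibres:
  assumes "finite A"
  shows "finite {y \<in> Y. \<pi> y \<in> A}"
proof (rule finite_subset)
  show "{y \<in> Y. \<pi> y \<in> A} \<subseteq> (\<Union>z\<in>A \<inter> Z. {y \<in> Y. \<pi> y = z})" using \<pi> by auto
  show "finite (\<Union>z\<in>A \<inter> Z. {y \<in> Y. \<pi> y = z})" using assms finite_fibre by auto
qed

lemma (in magnetic_graph) edge_swap: "(x, y) \<in> E \<Longrightarrow> (y, x) \<in> E"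
  using sym_E by (auto dest: symD)

sublocale weighted_magnetic_triangulation \<subseteq> star: weighted_fibration E r V c snd
proof
  fix x assume "x \<in> V"
  then have "finite {y. (x, y) \<in> E}" by (rule locally_finite)
  \<comment> \<open>Local finiteness speaks of edges leaving \<open>x\<close>, while the fibre
    consists of edges arriving at \<open>x\<close>; reversal matches them.\<close>
  then have "finite ((\<lambda>y. (y, x)) ` {y. (x, y) \<in> E})" by simp
  then show "finite {e \<in> E. snd e = x}"
    by (rule rev_finite_subset) (auto dest: edge_swap)
qed (use r_pos c_pos E_subset in auto)

sublocale weighted_magnetic_triangulation \<subseteq> face: weighted_fibration F s E r face_edge
proof
  fix e assume "e \<in> E"
  then obtain x y where e: "e = (x, y)" and "x \<in> V" using E_subset by (cases e) auto
  then have "finite {z. (x, z) \<in> E}" using locally_finite by auto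
  then have "finite ((\<lambda>z. (x, y, z)) ` {z. (x, z) \<in> E})" by simp
  then show "finite {t \<in> F. face_edge t = e}"
    by (rule rev_finite_subset) (auto simp: e face_edge_def dest: F_edges edge_swap)
qed (use s_pos F_edges in \<open>auto simp: face_edge_def\<close>)

context weighted_magnetic_triangulation
begin

lemma rotate_face_F: "t \<in> F \<Longrightarrow> rotate_face t \<in> F"
  by (cases t) (auto simp: rotate_face_def F_rotate)

lemma inj_rotate_face: "inj_on rotate_face A"
  by (auto simp: inj_on_def rotate_face_def)

lemma s_rotate_face: "t \<in> F \<Longrightarrow> s (rotate_face t) = s t"
  by (cases t) (auto simp: rotate_face_def s_rotate)

text \<open>Rotation has order three, so applying it twice gives the inverse.\<close>

lemma bij_rotate_face: "bij_betw rotate_face F F"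
  by (rule bij_betw_byWitness[of _ "rotate_face \<circ> rotate_face"])
     (auto simp: rotate_face_def F_rotate)

lemma bij_swap_edge: "bij_betw prod.swap E E"
  by (rule bij_betw_byWitness[of _ prod.swap]) (auto dest: edge_swap)

lemma sum_face_set:
  "(\<Sum>t\<in>face_set F x y. k (x, y, t)) = (\<Sum>t\<in>{t \<in> F. face_edge t = (x, y)}. k t)"
  by (rule sum.reindex_bij_witness[of _ "\<lambda>t. snd (snd t)" "\<lambda>t. (x, y, t)"])
     (auto simp: face_set_def face_edge_def)

lemma delta1_eq:
  assumes "e \<in> E"
  shows "delta1 E F \<alpha> r s \<psi> e =
    1 / of_real (r e) * (\<Sum>t\<in>{t \<in> F. face_edge t = e}. of_real (s t) * face_phase \<alpha> t * \<psi> t)"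
  using assms sum_face_set[of "\<lambda>t. of_real (s t) * face_phase \<alpha> t * \<psi> t"]
  by (cases e) (simp add: delta1_def face_phase_def)

text \<open>Skewness of \<alpha> identifies the phases. The three terms become one term evaluated at
  the three rotations, so the single projection to the first edge suffices.\<close>

lemma d1_eq:
  assumes "t \<in> F"
  shows "d1 F \<alpha> \<phi> t = cnj (face_phase \<alpha> t) * \<phi> (face_edge t)
    + cnj (face_phase \<alpha> (rotate_face t)) * \<phi> (face_edge (rotate_face t))
    + cnj (face_phase \<alpha> (rotate_face (rotate_face t))) * \<phi> (face_edge (rotate_face (rotate_face t)))"
proof -
  obtain x y z where t: "t = (x, y, z)" by (cases t)
  then have "(x, y) \<in> E" "(y, z) \<in> E" "(z, x) \<in> E" using assms F_edges by auto
  then have "\<alpha> (x, y) = - \<alpha> (y, x)" "\<alpha> (y, z) = - \<alpha> (z, y)" "\<alpha> (z, x) = - \<alpha> (x, z)"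
    by (auto intro: alpha_skew)
  then show ?thesis
    using assms unfolding t
    by (simp add: d1_def face_phase_def face_edge_def rotate_face_def cis_cnj diff_divide_distrib add_divide_distrib)
qed

section \<open>Commutator estimates\<close>

definition cutoff_bound :: "('a \<Rightarrow> real) \<Rightarrow> real \<Rightarrow> bool" where
  "cutoff_bound h C \<longleftrightarrow> 0 \<le> C \<and>
    (\<forall>x\<in>V. 1 / c x * (\<Sum>e\<in>{e \<in> E. snd e = x}. r e * (diff0 h e)\<^sup>2) \<le> C) \<and>
    (\<forall>e\<in>E. 1 / r e * (\<Sum>t\<in>{t \<in> F. face_edge t = e}. s t * (face_diff h t)\<^sup>2) \<le> C)"

text \<open>The constants are the squares of the factors 1/2 and 1/6 by which the means differ from
  vertex and edge values.\<close>

lemma cutoff_bound_scaled: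
  assumes "cutoff_bound h C"
  shows "x \<in> V \<Longrightarrow> 1 / c x * (\<Sum>e\<in>{e \<in> E. snd e = x}. r e * (diff0 h e / 2)\<^sup>2) \<le> C / 4"
    and "e \<in> E \<Longrightarrow> 1 / r e * (\<Sum>t\<in>{t \<in> F. face_edge t = e}. s t * (face_diff h t / 6)\<^sup>2) \<le> C / 36"
    and "0 \<le> C"
proof -
  have scale: "1 / a * (\<Sum>y\<in>A. v y * (g y / k)\<^sup>2) = (1 / a * (\<Sum>y\<in>A. v y * (g y)\<^sup>2)) / k\<^sup>2"
    for k a :: real and v g :: "'b \<Rightarrow> real" and A
    by (simp add: power_divide flip: sum_divide_distrib)
  show "x \<in> V \<Longrightarrow> 1 / c x * (\<Sum>e\<in>{e \<in> E. snd e = x}. r e * (diff0 h e / 2)\<^sup>2) \<le> C / 4"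
    "e \<in> E \<Longrightarrow> 1 / r e * (\<Sum>t\<in>{t \<in> F. face_edge t = e}. s t * (face_diff h t / 6)\<^sup>2) \<le> C / 36"
    "0 \<le> C"
    using assms unfolding cutoff_bound_def scale by auto
qed

lemma commutator_delta0:
  assumes h: "cutoff_bound h C" and \<phi>: "l2_le E r \<phi> B"
  shows "l2_le V c (\<lambda>x. delta0 V E \<alpha> c r (\<lambda>e. of_real (edge_mean h e) * \<phi> e) x
    - of_real (h x) * delta0 V E \<alpha> c r \<phi> x) (C / 4 * B)"
proof (rule star.l2_le_pushforward[OF \<phi> cutoff_bound_scaled(1)[OF h]])
  show "0 \<le> C / 4" using cutoff_bound_scaled(3)[OF h] by simp
  fix x assume x: "x \<in> V"
  let ?f = "{e \<in> E. snd e = x}"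
  have "delta0 V E \<alpha> c r (\<lambda>e. of_real (edge_mean h e) * \<phi> e) x - of_real (h x) * delta0 V E \<alpha> c r \<phi> x
    = 1 / of_real (c x) * (\<Sum>e\<in>?f. of_real (r e) * cis (\<alpha> e / 2) * (of_real (edge_mean h e) * \<phi> e)
        - of_real (h x) * (of_real (r e) * cis (\<alpha> e / 2) * \<phi> e))"
    using x by (simp add: delta0_def sum_subtractf sum_distrib_left sum_divide_distrib diff_divide_distrib)
  \<comment> \<open>For an edge ending at \<open>x\<close>, the edge mean minus \<open>h x\<close>
    is minus half of \<open>diff0 h e\<close>.\<close>
  also have "(\<Sum>e\<in>?f. of_real (r e) * cis (\<alpha> e / 2) * (of_real (edge_mean h e) * \<phi> e)
        - of_real (h x) * (of_real (r e) * cis (\<alpha> e / 2) * \<phi> e))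
    = (\<Sum>e\<in>?f. of_real (r e) * cis (\<alpha> e / 2) * (of_real (- (diff0 h e / 2)) * \<phi> e))"
    by (rule sum.cong) (auto simp: edge_mean_def diff0_def field_simps)
  also have "cmod (1 / of_real (c x) * \<dots>) \<le> 1 / c x *
      (\<Sum>e\<in>?f. cmod (of_real (r e) * cis (\<alpha> e / 2) * (of_real (- (diff0 h e / 2)) * \<phi> e)))"
    by (rule norm_weighted_sum_le[OF c_pos[OF x]])
  also have "(\<Sum>e\<in>?f. cmod (of_real (r e) * cis (\<alpha> e / 2) * (of_real (- (diff0 h e / 2)) * \<phi> e)))
    = (\<Sum>e\<in>?f. r e * (\<bar>diff0 h e / 2\<bar> * cmod (\<phi> e)))"
    using r_pos by (intro sum.cong) (auto simp: norm_mult norm_divide abs_of_pos)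
  finally show "cmod (delta0 V E \<alpha> c r (\<lambda>e. of_real (edge_mean h e) * \<phi> e) x
      - of_real (h x) * delta0 V E \<alpha> c r \<phi> x) \<le> 1 / c x * (\<Sum>e\<in>?f. r e * (\<bar>diff0 h e / 2\<bar> * cmod (\<phi> e)))" .
qed

lemma commutator_delta1:
  assumes h: "cutoff_bound h C" and \<psi>: "l2_le F s \<psi> B"
  shows "l2_le E r (\<lambda>e. delta1 E F \<alpha> r s (\<lambda>t. of_real (face_mean h t) * \<psi> t) e
    - of_real (edge_mean h e) * delta1 E F \<alpha> r s \<psi> e) (C / 36 * B)"
proof (rule face.l2_le_pushforward[OF \<psi> cutoff_bound_scaled(2)[OF h]])
  show "0 \<le> C / 36" using cutoff_bound_scaled(3)[OF h] by simp
  fix e assume e: "e \<in> E"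
  let ?f = "{t \<in> F. face_edge t = e}"
  have "delta1 E F \<alpha> r s (\<lambda>t. of_real (face_mean h t) * \<psi> t) e - of_real (edge_mean h e) * delta1 E F \<alpha> r s \<psi> e
    = 1 / of_real (r e) * (\<Sum>t\<in>?f. of_real (s t) * face_phase \<alpha> t * (of_real (face_mean h t) * \<psi> t)
        - of_real (edge_mean h e) * (of_real (s t) * face_phase \<alpha> t * \<psi> t))"
    using e by (simp add: delta1_eq sum_subtractf sum_distrib_left sum_divide_distrib diff_divide_distrib)
  \<comment> \<open>The face mean minus the mean over its first edge is minus one sixth of
    \<open>face_diff h t\<close>.\<close>
  also have "(\<Sum>t\<in>?f. of_real (s t) * face_phase \<alpha> t * (of_real (face_mean h t) * \<psi> t)
        - of_real (edge_mean h e) * (of_real (s t) * face_phase \<alpha> t * \<psi> t))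
    = (\<Sum>t\<in>?f. of_real (s t) * face_phase \<alpha> t * (of_real (- (face_diff h t / 6)) * \<psi> t))"
    by (rule sum.cong) (auto simp: edge_mean_def face_mean_def face_diff_def face_edge_def diff0_def field_simps)
  also have "cmod (1 / of_real (r e) * \<dots>) \<le> 1 / r e *
      (\<Sum>t\<in>?f. cmod (of_real (s t) * face_phase \<alpha> t * (of_real (- (face_diff h t / 6)) * \<psi> t)))"
    by (rule norm_weighted_sum_le[OF r_pos[OF e]])
  also have "(\<Sum>t\<in>?f. cmod (of_real (s t) * face_phase \<alpha> t * (of_real (- (face_diff h t / 6)) * \<psi> t)))
    = (\<Sum>t\<in>?f. s t * (\<bar>face_diff h t / 6\<bar> * cmod (\<psi> t)))"
    using s_pos by (intro sum.cong) (auto simp: norm_mult norm_divide abs_of_pos face_phase_def)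
  finally show "cmod (delta1 E F \<alpha> r s (\<lambda>t. of_real (face_mean h t) * \<psi> t) e
      - of_real (edge_mean h e) * delta1 E F \<alpha> r s \<psi> e)
    \<le> 1 / r e * (\<Sum>t\<in>?f. s t * (\<bar>face_diff h t / 6\<bar> * cmod (\<psi> t)))" .
qed

text \<open>Each end of an edge contributes half the difference of \<open>h\<close>. The head term
  is a pullback along \<open>snd\<close>, the tail term is the same after reversing the edge; each
  has bound \<open>C / 4 * B\<close>, and the triangle estimate doubles both.\<close>

lemma commutator_d0:
  assumes h: "cutoff_bound h C" and f: "l2_le V c f B"
  shows "l2_le E r (\<lambda>e. d0 E \<alpha> (\<lambda>x. of_real (h x) * f x) e - of_real (edge_mean h e) * d0 E \<alpha> f e) (C * B)"
proof -
  define a where "a = (\<lambda>e. complex_of_real (\<bar>diff0 h e / 2\<bar> * cmod (f (snd e))))"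
  have a: "l2_le E r a (C / 4 * B)"
    by (rule star.l2_le_pullback[OF f cutoff_bound_scaled(1)[OF h]])
       (use cutoff_bound_scaled(3)[OF h] in \<open>auto simp: a_def norm_mult\<close>)
  have a': "l2_le E r (\<lambda>e. a (prod.swap e)) (C / 4 * B)"
    using a by (rule l2_le_reindex) (auto simp: r_sym dest: edge_swap)
  have "l2_le E r (\<lambda>e. d0 E \<alpha> (\<lambda>x. of_real (h x) * f x) e - of_real (edge_mean h e) * d0 E \<alpha> f e)
      (2 * (C / 4 * B) + 2 * (C / 4 * B))"
  proof (rule star.Y.l2_le_triangle[OF a a'])
    fix e assume "e \<in> E"
    then obtain x y where e: "e = (x, y)" "(x, y) \<in> E" by (cases e) auto
    \<comment> \<open>Both terms get the same sign: the tail enters \<open>d0\<close> negatively and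
      lies on the other side of the mean.\<close>
    have "d0 E \<alpha> (\<lambda>x. of_real (h x) * f x) e - of_real (edge_mean h e) * d0 E \<alpha> f e
      = of_real (diff0 h e / 2) * (cis (\<alpha> (y, x) / 2) * f y) + of_real (diff0 h e / 2) * (cis (\<alpha> (x, y) / 2) * f x)"
      using e by (simp add: d0_def edge_mean_def diff0_def field_simps)
    also have "cmod \<dots> \<le> cmod (of_real (diff0 h e / 2) * (cis (\<alpha> (y, x) / 2) * f y))
        + cmod (of_real (diff0 h e / 2) * (cis (\<alpha> (x, y) / 2) * f x))"
      by (rule norm_triangle_ineq)
    also have "\<dots> = cmod (a e) + cmod (a (prod.swap e))"
      by (simp add: a_def e diff0_def norm_mult norm_divide abs_minus_commute flip: of_real_diff)
    finally show "cmod (d0 E \<alpha> (\<lambda>x. of_real (h x) * f x) e - of_real (edge_mean h e) * d0 E \<alpha> f e)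
      \<le> cmod (a e) + cmod (a (prod.swap e))" .
  qed
  then show ?thesis by (simp add: mult.commute)
qed

text \<open>The commutator is a sum of three rotated copies of one pullback, since the face mean is
  rotation invariant while the edge mean follows the rotated edge.\<close>

lemma commutator_d1:
  assumes h: "cutoff_bound h C" and \<phi>: "l2_le E r \<phi> B"
  shows "l2_le F s (\<lambda>t. d1 F \<alpha> (\<lambda>e. of_real (edge_mean h e) * \<phi> e) t
    - of_real (face_mean h t) * d1 F \<alpha> \<phi> t) (C * B)"
proof -
  define a where "a = (\<lambda>t. of_real (face_diff h t / 6) * (cnj (face_phase \<alpha> t) * \<phi> (face_edge t)))"
  let ?B = "C / 36 * B"
  have a: "l2_le F s a ?B"
    by (rule face.l2_le_pullback[OF \<phi> cutoff_bound_scaled(2)[OF h]])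
       (use cutoff_bound_scaled(3)[OF h] in \<open>auto simp: a_def norm_mult norm_divide face_phase_def\<close>)
  have step: "l2_le F s (\<lambda>t. b (rotate_face t)) B'" if "l2_le F s b B'" for b B'
    using that by (rule l2_le_reindex) (auto simp: inj_rotate_face rotate_face_F s_rotate_face)
  note a1 = step[OF a] and a2 = step[OF step[OF a]]
  have a12: "l2_le F s (\<lambda>t. a (rotate_face t) + a (rotate_face (rotate_face t))) (2 * ?B + 2 * ?B)"
    using a1 a2 by (rule face.Y.l2_le_triangle) (rule norm_triangle_ineq)
  have "l2_le F s (\<lambda>t. d1 F \<alpha> (\<lambda>e. of_real (edge_mean h e) * \<phi> e) t
      - of_real (face_mean h t) * d1 F \<alpha> \<phi> t) (2 * ?B + 2 * (2 * ?B + 2 * ?B))"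
  proof (rule face.Y.l2_le_triangle[OF a a12])
    fix t assume t: "t \<in> F"
    have mean: "edge_mean h (face_edge t) - face_mean h t = face_diff h t / 6"
      "face_mean h (rotate_face t) = face_mean h t" for t
      by (cases t, simp add: edge_mean_def face_mean_def face_diff_def face_edge_def rotate_face_def diff0_def field_simps)+
    have a_eq: "a t = (of_real (edge_mean h (face_edge t)) - of_real (face_mean h t)) * (cnj (face_phase \<alpha> t) * \<phi> (face_edge t))" for t
      by (simp only: a_def mean(1)[symmetric] of_real_diff)
    have "d1 F \<alpha> (\<lambda>e. of_real (edge_mean h e) * \<phi> e) t - of_real (face_mean h t) * d1 F \<alpha> \<phi> t
      = a t + (a (rotate_face t) + a (rotate_face (rotate_face t)))"
      unfolding d1_eq[OF t] a_eq mean(2) by (simp add: algebra_simps)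
    then show "cmod (d1 F \<alpha> (\<lambda>e. of_real (edge_mean h e) * \<phi> e) t - of_real (face_mean h t) * d1 F \<alpha> \<phi> t)
      \<le> cmod (a t) + cmod (a (rotate_face t) + a (rotate_face (rotate_face t)))"
      by (simp only: norm_triangle_ineq)
  qed
  then show ?thesis
    \<comment> \<open>The nested triangle estimates give 10/36 of \<open>C * B\<close>, which is
      rounded up.\<close>
    using cutoff_bound_scaled(3)[OF h] l2_le_nonneg[OF \<phi>] by (elim l2_le_mono) (simp add: mult_nonneg_nonneg)
qed

section \<open>Green's formulas\<close>

lemma finite_support_delta0:
  assumes "finite {e \<in> E. \<phi> e \<noteq> 0}"
  shows "finite {x \<in> V. delta0 V E \<alpha> c r \<phi> x \<noteq> 0}"
proof (rule finite_subset)
  show "{x \<in> V. delta0 V E \<alpha> c r \<phi> x \<noteq> 0} \<subseteq> snd ` {e \<in> E. \<phi> e \<noteq> 0}"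
  proof
    fix x assume "x \<in> {x \<in> V. delta0 V E \<alpha> c r \<phi> x \<noteq> 0}"
    then have "(\<Sum>e\<in>{e \<in> E. snd e = x}. of_real (r e) * cis (\<alpha> e / 2) * \<phi> e) \<noteq> 0"
      by (auto simp: delta0_def)
    then obtain e where "e \<in> E" "snd e = x" "of_real (r e) * cis (\<alpha> e / 2) * \<phi> e \<noteq> 0"
      by (rule sum.not_neutral_contains_not_neutral) auto
    then show "x \<in> snd ` {e \<in> E. \<phi> e \<noteq> 0}" by auto
  qed
qed (use assms in simp)

lemma finite_support_delta1:
  assumes "finite {t \<in> F. \<psi> t \<noteq> 0}"
  shows "finite {e \<in> E. delta1 E F \<alpha> r s \<psi> e \<noteq> 0}"
proof (rule finite_subset)
  show "{e \<in> E. delta1 E F \<alpha> r s \<psi> e \<noteq> 0} \<subseteq> face_edge ` {t \<in> F. \<psi> t \<noteq> 0}"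
  proof
    fix e assume "e \<in> {e \<in> E. delta1 E F \<alpha> r s \<psi> e \<noteq> 0}"
    then have "(\<Sum>t\<in>{t \<in> F. face_edge t = e}. of_real (s t) * face_phase \<alpha> t * \<psi> t) \<noteq> 0"
      by (auto simp: delta1_eq)
    then obtain t where "t \<in> F" "face_edge t = e" "of_real (s t) * face_phase \<alpha> t * \<psi> t \<noteq> 0"
      by (rule sum.not_neutral_contains_not_neutral) auto
    then show "e \<in> face_edge ` {t \<in> F. \<psi> t \<noteq> 0}" by auto
  qed
qed (use assms in simp)

lemma finite_edges_meeting:
  assumes "finite A"
  shows "finite {(x, y) \<in> E. x \<in> A \<or> y \<in> A}"
proof (rule finite_subset)
  let ?G = "{e \<in> E. snd e \<in> A}"
  show "{(x, y) \<in> E. x \<in> A \<or> y \<in> A} \<subseteq> ?G \<union> prod.swap ` ?G"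
    by (force dest: edge_swap)
  show "finite (?G \<union> prod.swap ` ?G)"
    using star.finite_vimage_fibres[OF assms] by simp
qed

text \<open>Finiteness of fibres controls only the first edge of a face; the other two edges become
  first edges after rotation.\<close>

lemma finite_faces_meeting:
  assumes "finite A"
  shows "finite {(x, y, z) \<in> F. (x, y) \<in> A \<or> (y, z) \<in> A \<or> (z, x) \<in> A}"
proof (rule finite_subset)
  let ?G = "{t \<in> F. face_edge t \<in> A}"
  let ?R = "rotate_face ` ?G"
  show "{(x, y, z) \<in> F. (x, y) \<in> A \<or> (y, z) \<in> A \<or> (z, x) \<in> A} \<subseteq> ?G \<union> ?R \<union> rotate_face ` ?R"
  proof (rule subsetI)
    fix p assume p: "p \<in> {(x, y, z) \<in> F. (x, y) \<in> A \<or> (y, z) \<in> A \<or> (z, x) \<in> A}"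
    obtain x y z where xyz: "p = (x, y, z)" by (cases p)
    have t: "(x, y, z) \<in> F" using p xyz by simp
    consider "(x, y) \<in> A" | "(y, z) \<in> A" | "(z, x) \<in> A" using p xyz by auto
    then show "p \<in> ?G \<union> ?R \<union> rotate_face ` ?R"
    proof cases
      case 1
      then show ?thesis using t by (simp add: face_edge_def xyz)
    next
      case 2
      then have "(y, z, x) \<in> ?G" using t by (simp add: face_edge_def F_rotate)
      then have "rotate_face (rotate_face (y, z, x)) \<in> rotate_face ` ?R" by (intro imageI)
      then show ?thesis by (simp add: rotate_face_def xyz)
    next
      case 3
      then have "(z, x, y) \<in> ?G" using t by (simp add: face_edge_def F_rotate)
      then have "rotate_face (z, x, y) \<in> ?R" by (intro imageI)
      then show ?thesis by (simp add: rotate_face_def xyz)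
    qed
  qed
  show "finite (?G \<union> ?R \<union> rotate_face ` ?R)"
    using face.finite_vimage_fibres[OF assms] by simp
qed

lemma finite_support_d0:
  assumes "finite {x \<in> V. f x \<noteq> 0}"
  shows "finite {e \<in> E. d0 E \<alpha> f e \<noteq> 0}"
  using finite_edges_meeting[OF assms] E_subset
  by (elim rev_finite_subset) (auto simp: d0_def)

lemma finite_support_d1:
  assumes "finite {e \<in> E. \<phi> e \<noteq> 0}"
  shows "finite {t \<in> F. d1 F \<alpha> \<phi> t \<noteq> 0}"
  using finite_faces_meeting[OF assms]
  by (elim rev_finite_subset) (auto simp: d1_def dest: F_edges)

lemma skew_E_swap: "\<phi> \<in> skew_E E \<Longrightarrow> (x, y) \<in> E \<Longrightarrow> \<phi> (x, y) = - \<phi> (y, x)"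
  unfolding skew_E_def by blast

text \<open>Summing over stars sees only the head of each edge. Averaging with the reversed edge
  brings in the tail, with the sign supplied by skewness, and produces the factor 1/2. Finite
  support of either factor is enough, since stars are finite.\<close>

lemma green_vertices_edges:
  assumes \<phi>: "\<phi> \<in> skew_E E" and fin: "finite {e \<in> E. \<phi> e \<noteq> 0} \<or> finite {x \<in> V. f x \<noteq> 0}"
  shows "(\<Sum>\<^sub>\<infinity>x\<in>V. of_real (c x) * delta0 V E \<alpha> c r \<phi> x * cnj (f x)) =
    (\<Sum>\<^sub>\<infinity>e\<in>E. of_real (r e / 2) * \<phi> e * cnj (d0 E \<alpha> f e))"
proof -
  define k where "k = (\<lambda>e. of_real (r e) * cis (\<alpha> e / 2) * \<phi> e * cnj (f (snd e)))"
  have k: "finite {e \<in> E. k e \<noteq> 0}"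
  proof -
    have "finite {e \<in> E. \<phi> e \<noteq> 0} \<or> finite {e \<in> E. snd e \<in> {x \<in> V. f x \<noteq> 0}}"
      using fin star.finite_vimage_fibres by blast
    then show ?thesis
      using star.\<pi> by (elim disjE rev_finite_subset) (auto simp: k_def)
  qed
  then have sk: "k summable_on E"
    by (rule finite_nonzero_values_imp_summable_on)
  have sk': "(\<lambda>e. k (prod.swap e)) summable_on E"
    using sk by (simp only: summable_on_reindex_bij_betw[OF bij_swap_edge])
  have "(\<Sum>\<^sub>\<infinity>x\<in>V. of_real (c x) * delta0 V E \<alpha> c r \<phi> x * cnj (f x)) = (\<Sum>\<^sub>\<infinity>x\<in>V. \<Sum>e\<in>{e \<in> E. snd e = x}. k e)"
  proof (rule infsum_cong)
    fix x assume x: "x \<in> V"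
    then show "of_real (c x) * delta0 V E \<alpha> c r \<phi> x * cnj (f x) = (\<Sum>e\<in>{e \<in> E. snd e = x}. k e)"
      using c_pos[OF x] by (simp add: delta0_def k_def sum_distrib_right)
  qed
  also have "\<dots> = (\<Sum>\<^sub>\<infinity>e\<in>E. k e)"
    by (rule star.infsum_fibres[OF k])
  also have "\<dots> = 1 / 2 * ((\<Sum>\<^sub>\<infinity>e\<in>E. k e) + (\<Sum>\<^sub>\<infinity>e\<in>E. k (prod.swap e)))"
    by (simp add: infsum_reindex_bij_betw[OF bij_swap_edge])
  also have "\<dots> = (\<Sum>\<^sub>\<infinity>e\<in>E. 1 / 2 * (k e + k (prod.swap e)))"
    by (simp only: infsum_add[OF sk sk'] infsum_cmult_right')
  also have "\<dots> = (\<Sum>\<^sub>\<infinity>e\<in>E. of_real (r e / 2) * \<phi> e * cnj (d0 E \<alpha> f e))"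
  proof (rule infsum_cong)
    fix e assume "e \<in> E"
    then obtain x y where e: "e = (x, y)" "(x, y) \<in> E" by (cases e) auto
    then have "\<phi> (y, x) = - \<phi> (x, y)" "r (y, x) = r (x, y)" "\<alpha> (y, x) = - \<alpha> (x, y)"
      using skew_E_swap[OF \<phi>] edge_swap r_sym alpha_skew by blast+
    then show "1 / 2 * (k e + k (prod.swap e)) = of_real (r e / 2) * \<phi> e * cnj (d0 E \<alpha> f e)"
      using e by (simp add: k_def d0_def cis_cnj field_simps)
  qed
  finally show ?thesis .
qed

lemma skew_F_permute:
  assumes "\<psi> \<in> skew_F F" "(x, y, z) \<in> F"
  shows "\<psi> (y, x, z) = - \<psi> (x, y, z)" "\<psi> (y, z, x) = \<psi> (x, y, z)"
  using assms unfolding skew_F_def by blast+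

lemma skew_F_rotate_face: "\<psi> \<in> skew_F F \<Longrightarrow> t \<in> F \<Longrightarrow> \<psi> (rotate_face t) = \<psi> t"
  by (cases t) (simp add: rotate_face_def skew_F_permute)

text \<open>Summing over fibres sees only the first edge of each face. Averaging over the three
  rotations, under which \<psi> is invariant, produces all terms of \<open>d1\<close> and turns 1/2
  into 1/6.\<close>

lemma green_edges_faces:
  assumes \<psi>: "\<psi> \<in> skew_F F" and fin: "finite {t \<in> F. \<psi> t \<noteq> 0} \<or> finite {e \<in> E. \<phi> e \<noteq> 0}"
  shows "(\<Sum>\<^sub>\<infinity>e\<in>E. of_real (r e / 2) * delta1 E F \<alpha> r s \<psi> e * cnj (\<phi> e)) =
    (\<Sum>\<^sub>\<infinity>t\<in>F. of_real (s t / 6) * \<psi> t * cnj (d1 F \<alpha> \<phi> t))"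
proof -
  define k where "k = (\<lambda>t. of_real (s t) * face_phase \<alpha> t * \<psi> t * cnj (\<phi> (face_edge t)))"
  let ?k1 = "\<lambda>t. k (rotate_face t)" and ?k2 = "\<lambda>t. k (rotate_face (rotate_face t))"
  have k: "finite {t \<in> F. k t \<noteq> 0}"
  proof -
    have "finite {t \<in> F. \<psi> t \<noteq> 0} \<or> finite {t \<in> F. face_edge t \<in> {e \<in> E. \<phi> e \<noteq> 0}}"
      using fin face.finite_vimage_fibres by blast
    then show ?thesis
      using face.\<pi> by (elim disjE rev_finite_subset) (auto simp: k_def)
  qed
  then have sk: "k summable_on F"
    by (rule finite_nonzero_values_imp_summable_on)
  have sk1: "?k1 summable_on F"
    using sk by (simp only: summable_on_reindex_bij_betw[OF bij_rotate_face])
  have sk2: "?k2 summable_on F"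
    using sk1 by (simp only: summable_on_reindex_bij_betw[OF bij_rotate_face, of ?k1])
  have "(\<Sum>\<^sub>\<infinity>e\<in>E. of_real (r e / 2) * delta1 E F \<alpha> r s \<psi> e * cnj (\<phi> e))
    = (\<Sum>\<^sub>\<infinity>e\<in>E. 1 / 2 * (\<Sum>t\<in>{t \<in> F. face_edge t = e}. k t))"
  proof (rule infsum_cong)
    fix e assume e: "e \<in> E"
    then show "of_real (r e / 2) * delta1 E F \<alpha> r s \<psi> e * cnj (\<phi> e) = 1 / 2 * (\<Sum>t\<in>{t \<in> F. face_edge t = e}. k t)"
      using r_pos[OF e] by (simp add: delta1_eq k_def sum_distrib_right)
  qed
  also have "\<dots> = 1 / 2 * (\<Sum>\<^sub>\<infinity>t\<in>F. k t)"
    by (simp only: infsum_cmult_right' face.infsum_fibres[OF k])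
  also have "\<dots> = 1 / 6 * ((\<Sum>\<^sub>\<infinity>t\<in>F. k t) + ((\<Sum>\<^sub>\<infinity>t\<in>F. ?k1 t) + (\<Sum>\<^sub>\<infinity>t\<in>F. ?k2 t)))"
    using infsum_reindex_bij_betw[OF bij_rotate_face, of k] infsum_reindex_bij_betw[OF bij_rotate_face, of ?k1]
    by simp
  also have "\<dots> = (\<Sum>\<^sub>\<infinity>t\<in>F. 1 / 6 * (k t + (?k1 t + ?k2 t)))"
    by (simp only: infsum_add[OF sk summable_on_add[OF sk1 sk2]] infsum_add[OF sk1 sk2] infsum_cmult_right')
  also have "\<dots> = (\<Sum>\<^sub>\<infinity>t\<in>F. of_real (s t / 6) * \<psi> t * cnj (d1 F \<alpha> \<phi> t))"
  proof (rule infsum_cong)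
    fix t assume t: "t \<in> F"
    then show "1 / 6 * (k t + (?k1 t + ?k2 t)) = of_real (s t / 6) * \<psi> t * cnj (d1 F \<alpha> \<phi> t)"
      by (simp add: d1_eq k_def skew_F_rotate_face[OF \<psi>] rotate_face_F s_rotate_face field_simps)
  qed
  finally show ?thesis .
qed

end

section \<open>The Gauss-Bonnet operator\<close>

lemma finite_Plus_Collect:
  "finite {p \<in> A <+> B. P p} \<longleftrightarrow> finite {a \<in> A. P (Inl a)} \<and> finite {b \<in> B. P (Inr b)}"
proof -
  have "{p \<in> A <+> B. P p} = {a \<in> A. P (Inl a)} <+> {b \<in> B. P (Inr b)}"
    by auto
  then show ?thesis by simp
qed

lemma skew_E_I:
  assumes "\<And>e. e \<notin> E \<Longrightarrow> \<phi> e = 0" "\<And>x y. (x, y) \<in> E \<Longrightarrow> \<phi> (x, y) = - \<phi> (y, x)"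
  shows "\<phi> \<in> skew_E E"
  unfolding skew_E_def using assms by blast

lemma skew_F_I:
  assumes "\<And>t. t \<notin> F \<Longrightarrow> \<psi> t = 0" "\<And>x y z. (x, y, z) \<in> F \<Longrightarrow> \<psi> (y, x, z) = - \<psi> (x, y, z)"
    "\<And>x y z. (x, y, z) \<in> F \<Longrightarrow> \<psi> (y, z, x) = \<psi> (x, y, z)"
  shows "\<psi> \<in> skew_F F"
  unfolding skew_F_def using assms by blast

lemma skew_E_zero: "\<phi> \<in> skew_E E \<Longrightarrow> e \<notin> E \<Longrightarrow> \<phi> e = 0"
  unfolding skew_E_def by blast

lemma skew_F_zero: "\<psi> \<in> skew_F F \<Longrightarrow> t \<notin> F \<Longrightarrow> \<psi> t = 0"
  unfolding skew_F_def by blast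

definition triple_coord :: "'a triple \<Rightarrow> 'a + 'a \<times> 'a + 'a \<times> 'a \<times> 'a \<Rightarrow> complex" where
  "triple_coord = (\<lambda>(f, \<phi>, \<psi>). case_sum f (case_sum \<phi> \<psi>))"

definition cell_mean :: "('a \<Rightarrow> real) \<Rightarrow> 'a + 'a \<times> 'a + 'a \<times> 'a \<times> 'a \<Rightarrow> real" where
  "cell_mean h = case_sum h (case_sum (edge_mean h) (face_mean h))"

definition mult_triple :: "('a \<Rightarrow> real) \<Rightarrow> 'a triple \<Rightarrow> 'a triple" where
  "mult_triple h = (\<lambda>(f, \<phi>, \<psi>). (\<lambda>x. of_real (h x) * f x,
     \<lambda>e. of_real (edge_mean h e) * \<phi> e, \<lambda>t. of_real (face_mean h t) * \<psi> t))"

definition triple_space :: "'a set \<Rightarrow> ('a \<times> 'a) set \<Rightarrow> ('a \<times> 'a \<times> 'a) set \<Rightarrow> 'a triple set" where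
  "triple_space V E F = fun_V V \<times> skew_E E \<times> skew_F F"

text \<open>Absorbing 1/2 and 1/6 makes \<open>ip_T\<close> a single weighted sum over all
  cells.\<close>

definition cell_weight :: "('a \<Rightarrow> real) \<Rightarrow> ('a \<times> 'a \<Rightarrow> real) \<Rightarrow> ('a \<times> 'a \<times> 'a \<Rightarrow> real) \<Rightarrow>
    'a + 'a \<times> 'a + 'a \<times> 'a \<times> 'a \<Rightarrow> real" where
  "cell_weight c r s = case_sum c (case_sum (\<lambda>e. r e / 2) (\<lambda>t. s t / 6))"

lemma triple_coord_simps [simp]:
  "triple_coord (f, \<phi>, \<psi>) (Inl x) = f x"
  "triple_coord (f, \<phi>, \<psi>) (Inr (Inl e)) = \<phi> e"
  "triple_coord (f, \<phi>, \<psi>) (Inr (Inr t)) = \<psi> t"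
  by (simp_all add: triple_coord_def)

lemma cell_weight_simps [simp]:
  "cell_weight c r s (Inl x) = c x"
  "cell_weight c r s (Inr (Inl e)) = r e / 2"
  "cell_weight c r s (Inr (Inr t)) = s t / 6"
  by (simp_all add: cell_weight_def)

lemma cell_mean_simps [simp]:
  "cell_mean h (Inl x) = h x"
  "cell_mean h (Inr (Inl e)) = edge_mean h e"
  "cell_mean h (Inr (Inr t)) = face_mean h t"
  by (simp_all add: cell_mean_def)

lemma triple_coord_diff: "triple_coord (u - v) p = triple_coord u p - triple_coord v p"
  by (cases u; cases v) (auto simp: triple_coord_def split: sum.split)

lemma triple_coord_mult: "triple_coord (mult_triple h u) p = of_real (cell_mean h p) * triple_coord u p"
  by (cases u) (auto simp: triple_coord_def mult_triple_def cell_mean_def split: sum.split)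

text \<open>Outside the cells both triples vanish by the extension by zero, so the coordinates on
  cells determine them.\<close>

lemma triple_coord_inj:
  assumes "u \<in> triple_space V E F" "v \<in> triple_space V E F"
    and eq: "\<And>p. p \<in> V <+> E <+> F \<Longrightarrow> triple_coord u p = triple_coord v p"
  shows "u = v"
proof -
  obtain f \<phi> \<psi> f' \<phi>' \<psi>' where u: "u = (f, \<phi>, \<psi>)" and v: "v = (f', \<phi>', \<psi>')"
    by (metis prod_cases3)
  have "f \<in> fun_V V" "f' \<in> fun_V V" "\<phi> \<in> skew_E E" "\<phi>' \<in> skew_E E" "\<psi> \<in> skew_F F" "\<psi>' \<in> skew_F F"
    using assms(1,2) by (auto simp: u v triple_space_def)
  then have z: "x \<notin> V \<Longrightarrow> f x = 0" "x \<notin> V \<Longrightarrow> f' x = 0" "e \<notin> E \<Longrightarrow> \<phi> e = 0" "e \<notin> E \<Longrightarrow> \<phi>' e = 0"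
    "t \<notin> F \<Longrightarrow> \<psi> t = 0" "t \<notin> F \<Longrightarrow> \<psi>' t = 0" for x e t
    by (simp_all add: fun_V_def skew_E_zero skew_F_zero)
  have "f x = f' x" for x
    using eq[of "Inl x"] z(1,2)[of x] by (cases "x \<in> V") (auto simp: u v)
  moreover have "\<phi> e = \<phi>' e" for e
    using eq[of "Inr (Inl e)"] z(3,4)[of e] by (cases "e \<in> E") (auto simp: u v)
  moreover have "\<psi> t = \<psi>' t" for t
    using eq[of "Inr (Inr t)"] z(5,6)[of t] by (cases "t \<in> F") (auto simp: u v)
  ultimately show ?thesis unfolding u v by auto
qed

context weighted_magnetic_triangulation
begin

abbreviation cells :: "('a + 'a \<times> 'a + 'a \<times> 'a \<times> 'a) set" where
  "cells \<equiv> V <+> E <+> F"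

abbreviation wt :: "'a + 'a \<times> 'a + 'a \<times> 'a \<times> 'a \<Rightarrow> real" where
  "wt \<equiv> cell_weight c r s"

abbreviation T :: "'a triple \<Rightarrow> 'a triple" where
  "T \<equiv> gauss_bonnet V E \<alpha> F c r s"

lemma cell_weight_pos: "p \<in> cells \<Longrightarrow> 0 < wt p"
  using c_pos r_pos s_pos by auto

section \<open>The formal operator on all triples and its commutators\<close>

lemma triple_space_diff:
  assumes "u \<in> triple_space V E F" "v \<in> triple_space V E F"
  shows "u - v \<in> triple_space V E F"
proof -
  obtain f \<phi> \<psi> f' \<phi>' \<psi>' where u: "u = (f, \<phi>, \<psi>)" and v: "v = (f', \<phi>', \<psi>')"
    by (metis prod_cases3)
  have f: "f \<in> fun_V V" "f' \<in> fun_V V" and \<phi>: "\<phi> \<in> skew_E E" "\<phi>' \<in> skew_E E"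
    and \<psi>: "\<psi> \<in> skew_F F" "\<psi>' \<in> skew_F F"
    using assms by (auto simp: u v triple_space_def)
  have "f - f' \<in> fun_V V" using f by (auto simp: fun_V_def)
  moreover have "\<phi> - \<phi>' \<in> skew_E E"
  proof (rule skew_E_I)
    show "(\<phi> - \<phi>') (x, y) = - (\<phi> - \<phi>') (y, x)" if "(x, y) \<in> E" for x y
      unfolding fun_diff_def by (simp only: skew_E_swap[OF \<phi>(1) that] skew_E_swap[OF \<phi>(2) that]) simp
  qed (use \<phi> in \<open>simp add: skew_E_zero\<close>)
  moreover have "\<psi> - \<psi>' \<in> skew_F F"
    by (rule skew_F_I) (use \<psi> in \<open>simp_all add: skew_F_zero skew_F_permute\<close>)
  ultimately show ?thesis by (simp add: u v triple_space_def)
qed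

text \<open>Skewness survives because the means do not depend on the order of the vertices.\<close>

lemma mult_triple_space:
  assumes "u \<in> triple_space V E F"
  shows "mult_triple h u \<in> triple_space V E F"
proof -
  obtain f \<phi> \<psi> where u: "u = (f, \<phi>, \<psi>)" by (cases u)
  have f: "f \<in> fun_V V" and \<phi>: "\<phi> \<in> skew_E E" and \<psi>: "\<psi> \<in> skew_F F"
    using assms by (auto simp: u triple_space_def)
  have "(\<lambda>x. of_real (h x) * f x) \<in> fun_V V" using f by (auto simp: fun_V_def)
  moreover have "(\<lambda>e. of_real (edge_mean h e) * \<phi> e) \<in> skew_E E"
  proof (rule skew_E_I)
    show "of_real (edge_mean h (x, y)) * \<phi> (x, y) = - (of_real (edge_mean h (y, x)) * \<phi> (y, x))"
      if "(x, y) \<in> E" for x y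
      unfolding skew_E_swap[OF \<phi> that] by (simp add: edge_mean_def add.commute)
  qed (use \<phi> in \<open>simp add: skew_E_zero\<close>)
  moreover have "(\<lambda>t. of_real (face_mean h t) * \<psi> t) \<in> skew_F F"
    by (rule skew_F_I) (use \<psi> in \<open>simp_all add: skew_F_zero skew_F_permute face_mean_def add_ac\<close>)
  ultimately show ?thesis by (simp add: u mult_triple_def triple_space_def)
qed

lemma d0_skew: "d0 E \<alpha> f \<in> skew_E E"
  by (rule skew_E_I) (auto simp: d0_def dest: edge_swap)

lemma delta1_skew:
  assumes "\<psi> \<in> skew_F F"
  shows "delta1 E F \<alpha> r s \<psi> \<in> skew_E E"
proof (rule skew_E_I)
  show "delta1 E F \<alpha> r s \<psi> e = 0" if "e \<notin> E" for e
    using that by (cases e) (simp add: delta1_def)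
  fix x y assume xy: "(x, y) \<in> E"
  have "face_set F y x = face_set F x y"
    by (auto simp: face_set_def intro: F_swap)
  moreover have "of_real (s (y, x, t)) * cis ((\<alpha> (t, y) + \<alpha> (t, x)) / 6) * \<psi> (y, x, t)
    = - (of_real (s (x, y, t)) * cis ((\<alpha> (t, x) + \<alpha> (t, y)) / 6) * \<psi> (x, y, t))" if "t \<in> face_set F x y" for t
    using that skew_F_permute(1)[OF assms] s_swap by (simp add: face_set_def add.commute)
  ultimately show "delta1 E F \<alpha> r s \<psi> (x, y) = - delta1 E F \<alpha> r s \<psi> (y, x)"
    using xy edge_swap[OF xy] r_sym[OF xy] by (simp add: delta1_def sum_negf)
qed

lemma d1_skew:
  assumes \<phi>: "\<phi> \<in> skew_E E"
  shows "d1 F \<alpha> \<phi> \<in> skew_F F"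
proof (rule skew_F_I)
  show "d1 F \<alpha> \<phi> t = 0" if "t \<notin> F" for t
    using that by (cases t) (simp add: d1_def)
next
  fix x y z assume t: "(x, y, z) \<in> F"
  then have E: "(y, x) \<in> E" "(z, y) \<in> E" "(x, z) \<in> E" using F_edges edge_swap by blast+
  show "d1 F \<alpha> \<phi> (y, x, z) = - d1 F \<alpha> \<phi> (x, y, z)"
    using t F_swap[OF t] skew_E_swap[OF \<phi> E(1)] skew_E_swap[OF \<phi> E(2)] skew_E_swap[OF \<phi> E(3)]
    by (simp add: d1_def add.commute)
  show "d1 F \<alpha> \<phi> (y, z, x) = d1 F \<alpha> \<phi> (x, y, z)"
    using t F_rotate[OF t] by (simp add: d1_def add_ac)
qed

lemma gauss_bonnet_space:
  assumes "u \<in> triple_space V E F"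
  shows "T u \<in> triple_space V E F"
proof -
  obtain f \<phi> \<psi> where u: "u = (f, \<phi>, \<psi>)" by (cases u)
  have \<phi>: "\<phi> \<in> skew_E E" and \<psi>: "\<psi> \<in> skew_F F"
    using assms by (auto simp: u triple_space_def)
  have "(\<lambda>e. d0 E \<alpha> f e + delta1 E F \<alpha> r s \<psi> e) \<in> skew_E E"
  proof (rule skew_E_I)
    fix x y assume xy: "(x, y) \<in> E"
    show "d0 E \<alpha> f (x, y) + delta1 E F \<alpha> r s \<psi> (x, y) = - (d0 E \<alpha> f (y, x) + delta1 E F \<alpha> r s \<psi> (y, x))"
      using skew_E_swap[OF d0_skew xy, of f] skew_E_swap[OF delta1_skew[OF \<psi>] xy] by simp
  qed (simp add: skew_E_zero[OF d0_skew] skew_E_zero[OF delta1_skew[OF \<psi>]])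
  then show ?thesis
    using d1_skew[OF \<phi>] by (simp add: u gauss_bonnet_def triple_space_def fun_V_def delta0_def)
qed

lemma gauss_bonnet_diff:
  assumes "p \<in> cells"
  shows "triple_coord (T (u - v)) p = triple_coord (T u) p - triple_coord (T v) p"
proof -
  obtain f \<phi> \<psi> f' \<phi>' \<psi>' where u: "u = (f, \<phi>, \<psi>)" and v: "v = (f', \<phi>', \<psi>')"
    by (metis prod_cases3)
  have "delta0 V E \<alpha> c r (\<phi> - \<phi>') x = delta0 V E \<alpha> c r \<phi> x - delta0 V E \<alpha> c r \<phi>' x" for x
    by (simp add: delta0_def right_diff_distrib sum_subtractf diff_divide_distrib)
  moreover have "d0 E \<alpha> (f - f') e = d0 E \<alpha> f e - d0 E \<alpha> f' e" for e
    by (cases e) (simp add: d0_def algebra_simps)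
  moreover have "delta1 E F \<alpha> r s (\<psi> - \<psi>') e = delta1 E F \<alpha> r s \<psi> e - delta1 E F \<alpha> r s \<psi>' e" for e
    by (cases e) (simp add: delta1_def right_diff_distrib sum_subtractf diff_divide_distrib)
  moreover have "d1 F \<alpha> (\<phi> - \<phi>') t = d1 F \<alpha> \<phi> t - d1 F \<alpha> \<phi>' t" for t
    by (cases t) (simp add: d1_def algebra_simps)
  ultimately show ?thesis
    using assms by (auto simp: u v gauss_bonnet_def)
qed

text \<open>The vertex, edge and face components contribute 1/2, 1 + 1/6 and 1/3 times
  \<open>C * B\<close>, which add up to \<open>2 * C * B\<close>.\<close>

lemma gauss_bonnet_commutator:
  assumes h: "cutoff_bound h C" and u: "l2_le cells wt (triple_coord u) B"
  shows "l2_le cells wt (\<lambda>p. triple_coord (T (mult_triple h u)) p - triple_coord (mult_triple h (T u)) p)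
    (2 * C * B)"
proof -
  obtain f \<phi> \<psi> where u_eq: "u = (f, \<phi>, \<psi>)" by (cases u)
  let ?c = "\<lambda>p. triple_coord (T (mult_triple h u)) p - triple_coord (mult_triple h (T u)) p"
  have C: "0 \<le> C" using cutoff_bound_scaled(3)[OF h] .
  note u' = u[unfolded cell_weight_def]
  have f: "l2_le V c f B"
    using l2_le_PlusD(1)[OF u'] by (simp add: u_eq)
  \<comment> \<open>The factors 2 and 6 undo the scaling of the weights on edges and faces.\<close>
  have \<phi>: "l2_le E r \<phi> (2 * B)"
    using l2_le_PlusD(1)[OF l2_le_PlusD(2)[OF u']] by (simp add: u_eq l2_le_scale)
  have \<psi>: "l2_le F s \<psi> (6 * B)"
    using l2_le_PlusD(2)[OF l2_le_PlusD(2)[OF u']] by (simp add: u_eq l2_le_scale)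
  have "l2_le V c (\<lambda>x. ?c (Inl x)) (C / 4 * (2 * B))"
    using commutator_delta0[OF h \<phi>] by (simp add: u_eq gauss_bonnet_def mult_triple_def)
  moreover have "l2_le E (\<lambda>e. r e / 2) (\<lambda>e. ?c (Inr (Inl e))) (C * B + C / 36 * (6 * B))"
  proof -
    have "l2_le E r (\<lambda>e. ?c (Inr (Inl e))) (2 * (C * B) + 2 * (C / 36 * (6 * B)))"
    proof (rule star.Y.l2_le_triangle[OF commutator_d0[OF h f] commutator_delta1[OF h \<psi>]])
      fix e
      let ?a = "d0 E \<alpha> (\<lambda>x. of_real (h x) * f x) e - of_real (edge_mean h e) * d0 E \<alpha> f e"
      let ?b = "delta1 E F \<alpha> r s (\<lambda>t. of_real (face_mean h t) * \<psi> t) e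
        - of_real (edge_mean h e) * delta1 E F \<alpha> r s \<psi> e"
      have "?c (Inr (Inl e)) = ?a + ?b"
        by (simp add: u_eq gauss_bonnet_def mult_triple_def algebra_simps)
      then show "cmod (?c (Inr (Inl e))) \<le> cmod ?a + cmod ?b"
        by (simp only: norm_triangle_ineq)
    qed
    then show ?thesis by (simp add: l2_le_scale)
  qed
  moreover have "l2_le F (\<lambda>t. s t / 6) (\<lambda>t. ?c (Inr (Inr t))) (C * (2 * B) / 6)"
    using commutator_d1[OF h \<phi>]
    by (simp add: u_eq gauss_bonnet_def mult_triple_def l2_le_scale mult_ac)
  ultimately have "l2_le cells wt ?c (C / 4 * (2 * B) + ((C * B + C / 36 * (6 * B)) + C * (2 * B) / 6))"
    unfolding cell_weight_def by (intro l2_le_Plus)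
  moreover have "C / 4 * (2 * B) + ((C * B + C / 36 * (6 * B)) + C * (2 * B) / 6) = 2 * C * B"
    by (simp add: field_simps)
  ultimately show ?thesis by (simp only:)
qed

section \<open>Identification of the domain, the Hilbert space and the inner product\<close>

lemma gb_domain_eq:
  "gb_domain V E F = {u \<in> triple_space V E F. finite {p \<in> cells. triple_coord u p \<noteq> 0}}"
proof (rule set_eqI)
  fix u :: "'a triple"
  obtain f \<phi> \<psi> where u: "u = (f, \<phi>, \<psi>)" by (cases u)
  have "{x. f x \<noteq> 0} = {x \<in> V. f x \<noteq> 0}" if "f \<in> fun_V V" using that by (auto simp: fun_V_def)
  moreover have "{e. \<phi> e \<noteq> 0} = {e \<in> E. \<phi> e \<noteq> 0}" if "\<phi> \<in> skew_E E" using skew_E_zero[OF that] by blast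
  moreover have "{t. \<psi> t \<noteq> 0} = {t \<in> F. \<psi> t \<noteq> 0}" if "\<psi> \<in> skew_F F" using skew_F_zero[OF that] by blast
  ultimately show "u \<in> gb_domain V E F \<longleftrightarrow>
      u \<in> {u \<in> triple_space V E F. finite {p \<in> cells. triple_coord u p \<noteq> 0}}"
    by (auto simp: u gb_domain_def triple_space_def fin_supp_def finite_Plus_Collect)
qed

lemma l2_T_eq:
  "l2_T V E F c r s = {u \<in> triple_space V E F. l2_summable cells wt (triple_coord u)}"
proof (rule set_eqI)
  fix u :: "'a triple"
  obtain f \<phi> \<psi> where u: "u = (f, \<phi>, \<psi>)" by (cases u)
  have scale: "(\<lambda>y. q y / k) summable_on A \<longleftrightarrow> q summable_on A"
    if "k \<noteq> 0" for k :: real and q :: "'b \<Rightarrow> real" and A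
    using summable_on_cmult_right'[of "1 / k" q A] that by simp
  show "u \<in> l2_T V E F c r s \<longleftrightarrow>
      u \<in> {u \<in> triple_space V E F. l2_summable cells wt (triple_coord u)}"
    by (auto simp: u l2_T_def l2_V_def l2_E_def l2_F_def triple_space_def l2_summable_def
        summable_on_Plus_iff scale)
qed

lemma ip_T_eq:
  assumes "u \<in> l2_T V E F c r s" "v \<in> l2_T V E F c r s"
  shows "ip_T V E F c r s u v =
    (\<Sum>\<^sub>\<infinity>p\<in>cells. of_real (wt p) * triple_coord u p * cnj (triple_coord v p))"
proof -
  obtain f \<phi> \<psi> f' \<phi>' \<psi>' where u: "u = (f, \<phi>, \<psi>)" and v: "v = (f', \<phi>', \<psi>')"
    by (metis prod_cases3)
  interpret weight cells wt by unfold_locales (rule cell_weight_pos)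
  let ?k = "\<lambda>p. of_real (wt p) * triple_coord u p * cnj (triple_coord v p)"
  have "?k summable_on cells"
    using assms by (intro l2_Cauchy_Schwarz(1)) (simp_all add: l2_T_eq)
  then have s: "(\<lambda>x. ?k (Inl x)) summable_on V" "(\<lambda>p. ?k (Inr p)) summable_on (E <+> F)"
    "(\<lambda>e. ?k (Inr (Inl e))) summable_on E" "(\<lambda>t. ?k (Inr (Inr t))) summable_on F"
    by (simp_all only: summable_on_Plus_iff)
  have "infsum ?k cells = (\<Sum>\<^sub>\<infinity>x\<in>V. ?k (Inl x)) + ((\<Sum>\<^sub>\<infinity>e\<in>E. ?k (Inr (Inl e))) + (\<Sum>\<^sub>\<infinity>t\<in>F. ?k (Inr (Inr t))))"
    by (simp only: infsum_Plus[OF s(1,2)] infsum_Plus[OF s(3,4)])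
  also have "\<dots> = ip_T V E F c r s u v"
    by (simp add: u v ip_T_def ip_V_def ip_E_def ip_F_def mult.assoc flip: infsum_cmult_right')
  finally show ?thesis by simp
qed

lemma gauss_bonnet_domain:
  assumes "u \<in> gb_domain V E F"
  shows "T u \<in> gb_domain V E F"
proof -
  obtain f \<phi> \<psi> where u: "u = (f, \<phi>, \<psi>)" by (cases u)
  have S: "u \<in> triple_space V E F"
    and f: "finite {x \<in> V. f x \<noteq> 0}" and \<phi>: "finite {e \<in> E. \<phi> e \<noteq> 0}" and \<psi>: "finite {t \<in> F. \<psi> t \<noteq> 0}"
    using assms by (auto simp: gb_domain_eq u finite_Plus_Collect)
  have "finite {e \<in> E. d0 E \<alpha> f e + delta1 E F \<alpha> r s \<psi> e \<noteq> 0}"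
    by (rule finite_subset[OF _ finite_UnI[OF finite_support_d0[OF f] finite_support_delta1[OF \<psi>]]]) auto
  then show ?thesis
    using gauss_bonnet_space[OF S] finite_support_delta0[OF \<phi>] finite_support_d1[OF \<phi>]
    by (simp add: gb_domain_eq u finite_Plus_Collect gauss_bonnet_def)
qed

text \<open>Four pairings occur: each of the two Green's formulas is used once directly and once
  conjugated, because \<open>u\<close> supplies the finitely supported factor on either side of
  it.\<close>

lemma gauss_bonnet_green:
  assumes uD: "u \<in> gb_domain V E F" and vS: "v \<in> triple_space V E F"
  shows "(\<Sum>\<^sub>\<infinity>p\<in>cells. of_real (wt p) * triple_coord (T u) p * cnj (triple_coord v p)) =
    (\<Sum>\<^sub>\<infinity>p\<in>cells. of_real (wt p) * triple_coord u p * cnj (triple_coord (T v) p))"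
proof -
  obtain f \<phi> \<psi> f' \<phi>' \<psi>' where u: "u = (f, \<phi>, \<psi>)" and v: "v = (f', \<phi>', \<psi>')"
    by (metis prod_cases3)
  have \<phi>: "\<phi> \<in> skew_E E" and \<psi>: "\<psi> \<in> skew_F F" and \<phi>': "\<phi>' \<in> skew_E E" and \<psi>': "\<psi>' \<in> skew_F F"
    and ff: "finite {x \<in> V. f x \<noteq> 0}" and f\<phi>: "finite {e \<in> E. \<phi> e \<noteq> 0}" and f\<psi>: "finite {t \<in> F. \<psi> t \<noteq> 0}"
    using uD vS by (auto simp: gb_domain_eq u v triple_space_def finite_Plus_Collect)
  have summ: "(\<lambda>y. a y * b y * d y) summable_on A" if "finite {y \<in> A. b y \<noteq> 0}"
    for a b d :: "'b \<Rightarrow> complex" and A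
    using that by (intro finite_nonzero_values_imp_summable_on) (auto elim: rev_finite_subset)
  have split: "(\<Sum>\<^sub>\<infinity>p\<in>cells. of_real (wt p) * triple_coord (f1, \<phi>1, \<psi>1) p * cnj (triple_coord (f2, \<phi>2, \<psi>2) p))
    = (\<Sum>\<^sub>\<infinity>x\<in>V. of_real (c x) * f1 x * cnj (f2 x))
      + ((\<Sum>\<^sub>\<infinity>e\<in>E. of_real (r e / 2) * \<phi>1 e * cnj (\<phi>2 e)) + (\<Sum>\<^sub>\<infinity>t\<in>F. of_real (s t / 6) * \<psi>1 t * cnj (\<psi>2 t)))"
    if "finite {x \<in> V. f1 x \<noteq> 0}" "finite {e \<in> E. \<phi>1 e \<noteq> 0}" "finite {t \<in> F. \<psi>1 t \<noteq> 0}"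
    for f1 f2 \<phi>1 \<phi>2 \<psi>1 \<psi>2
  proof -
    let ?k = "\<lambda>p. of_real (wt p) * triple_coord (f1, \<phi>1, \<psi>1) p * cnj (triple_coord (f2, \<phi>2, \<psi>2) p)"
    have V: "(\<lambda>x. ?k (Inl x)) summable_on V" and E: "(\<lambda>e. ?k (Inr (Inl e))) summable_on E"
      and F: "(\<lambda>t. ?k (Inr (Inr t))) summable_on F"
      unfolding triple_coord_simps by (intro summ that)+
    have EF: "(\<lambda>p. ?k (Inr p)) summable_on (E <+> F)"
      using E F by (simp only: summable_on_Plus_iff)
    show ?thesis
      by (simp only: infsum_Plus[OF V EF] infsum_Plus[OF E F] triple_coord_simps cell_weight_simps)
  qed
  \<comment> \<open>Green's formulas have \<open>delta0\<close> and \<open>delta1\<close> in the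
    left factor; conjugate symmetry covers \<open>d0\<close> and \<open>d1\<close> there.\<close>
  have flip: "(\<Sum>\<^sub>\<infinity>y\<in>A. of_real (k y) * a y * cnj (b y)) = cnj (\<Sum>\<^sub>\<infinity>y\<in>A. of_real (k y) * b y * cnj (a y))"
    for k and a b :: "'b \<Rightarrow> complex" and A
    unfolding infsum_cnj[symmetric] by (intro infsum_cong) (simp add: ac_simps)
  have "(\<Sum>\<^sub>\<infinity>p\<in>cells. of_real (wt p) * triple_coord (T u) p * cnj (triple_coord v p))
    = (\<Sum>\<^sub>\<infinity>x\<in>V. of_real (c x) * delta0 V E \<alpha> c r \<phi> x * cnj (f' x))
      + ((\<Sum>\<^sub>\<infinity>e\<in>E. of_real (r e / 2) * (d0 E \<alpha> f e + delta1 E F \<alpha> r s \<psi> e) * cnj (\<phi>' e))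
      + (\<Sum>\<^sub>\<infinity>t\<in>F. of_real (s t / 6) * d1 F \<alpha> \<phi> t * cnj (\<psi>' t)))"
    unfolding u v gauss_bonnet_def case_prod_conv
    by (rule split)
       (use gauss_bonnet_domain[OF uD] in \<open>simp_all add: u gauss_bonnet_def gb_domain_eq finite_Plus_Collect\<close>)
  also have "(\<Sum>\<^sub>\<infinity>e\<in>E. of_real (r e / 2) * (d0 E \<alpha> f e + delta1 E F \<alpha> r s \<psi> e) * cnj (\<phi>' e))
    = (\<Sum>\<^sub>\<infinity>e\<in>E. of_real (r e / 2) * d0 E \<alpha> f e * cnj (\<phi>' e))
      + (\<Sum>\<^sub>\<infinity>e\<in>E. of_real (r e / 2) * delta1 E F \<alpha> r s \<psi> e * cnj (\<phi>' e))"
    unfolding distrib_left distrib_right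
    by (intro infsum_add summ finite_support_d0 finite_support_delta1 ff f\<psi>)
  also have "(\<Sum>\<^sub>\<infinity>x\<in>V. of_real (c x) * delta0 V E \<alpha> c r \<phi> x * cnj (f' x))
    = (\<Sum>\<^sub>\<infinity>e\<in>E. of_real (r e / 2) * \<phi> e * cnj (d0 E \<alpha> f' e))"
    using \<phi> f\<phi> by (intro green_vertices_edges) auto
  also have "(\<Sum>\<^sub>\<infinity>e\<in>E. of_real (r e / 2) * d0 E \<alpha> f e * cnj (\<phi>' e))
    = (\<Sum>\<^sub>\<infinity>x\<in>V. of_real (c x) * f x * cnj (delta0 V E \<alpha> c r \<phi>' x))"
    by (subst (1 2) flip, subst green_vertices_edges[OF \<phi>']) (use ff in auto)
  also have "(\<Sum>\<^sub>\<infinity>e\<in>E. of_real (r e / 2) * delta1 E F \<alpha> r s \<psi> e * cnj (\<phi>' e))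
    = (\<Sum>\<^sub>\<infinity>t\<in>F. of_real (s t / 6) * \<psi> t * cnj (d1 F \<alpha> \<phi>' t))"
    using \<psi> f\<psi> by (intro green_edges_faces) auto
  also have "(\<Sum>\<^sub>\<infinity>t\<in>F. of_real (s t / 6) * d1 F \<alpha> \<phi> t * cnj (\<psi>' t))
    = (\<Sum>\<^sub>\<infinity>e\<in>E. of_real (r e / 2) * \<phi> e * cnj (delta1 E F \<alpha> r s \<psi>' e))"
    by (subst (1 2) flip, subst green_edges_faces[OF \<psi>']) (use f\<phi> in auto)
  \<comment> \<open>Regrouping puts the two edge sums next to each other, so that they recombine
    into the edge component of \<open>T v\<close>.\<close>
  also have "(\<Sum>\<^sub>\<infinity>e\<in>E. of_real (r e / 2) * \<phi> e * cnj (d0 E \<alpha> f' e))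
      + ((\<Sum>\<^sub>\<infinity>x\<in>V. of_real (c x) * f x * cnj (delta0 V E \<alpha> c r \<phi>' x))
        + (\<Sum>\<^sub>\<infinity>t\<in>F. of_real (s t / 6) * \<psi> t * cnj (d1 F \<alpha> \<phi>' t))
        + (\<Sum>\<^sub>\<infinity>e\<in>E. of_real (r e / 2) * \<phi> e * cnj (delta1 E F \<alpha> r s \<psi>' e)))
    = (\<Sum>\<^sub>\<infinity>x\<in>V. of_real (c x) * f x * cnj (delta0 V E \<alpha> c r \<phi>' x))
      + (((\<Sum>\<^sub>\<infinity>e\<in>E. of_real (r e / 2) * \<phi> e * cnj (d0 E \<alpha> f' e))
        + (\<Sum>\<^sub>\<infinity>e\<in>E. of_real (r e / 2) * \<phi> e * cnj (delta1 E F \<alpha> r s \<psi>' e)))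
        + (\<Sum>\<^sub>\<infinity>t\<in>F. of_real (s t / 6) * \<psi> t * cnj (d1 F \<alpha> \<phi>' t)))"
    by (simp only: add_ac)
  also have "(\<Sum>\<^sub>\<infinity>e\<in>E. of_real (r e / 2) * \<phi> e * cnj (d0 E \<alpha> f' e))
        + (\<Sum>\<^sub>\<infinity>e\<in>E. of_real (r e / 2) * \<phi> e * cnj (delta1 E F \<alpha> r s \<psi>' e))
    = (\<Sum>\<^sub>\<infinity>e\<in>E. of_real (r e / 2) * \<phi> e * cnj (d0 E \<alpha> f' e + delta1 E F \<alpha> r s \<psi>' e))"
    unfolding complex_cnj_add distrib_left
    by (intro infsum_add[symmetric] summ f\<phi>)
  also have "(\<Sum>\<^sub>\<infinity>x\<in>V. of_real (c x) * f x * cnj (delta0 V E \<alpha> c r \<phi>' x))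
      + ((\<Sum>\<^sub>\<infinity>e\<in>E. of_real (r e / 2) * \<phi> e * cnj (d0 E \<alpha> f' e + delta1 E F \<alpha> r s \<psi>' e))
        + (\<Sum>\<^sub>\<infinity>t\<in>F. of_real (s t / 6) * \<psi> t * cnj (d1 F \<alpha> \<phi>' t)))
    = (\<Sum>\<^sub>\<infinity>p\<in>cells. of_real (wt p) * triple_coord u p * cnj (triple_coord (T v) p))"
    unfolding u v gauss_bonnet_def case_prod_conv by (rule split[symmetric]) (fact ff f\<phi> f\<psi>)+
  finally show ?thesis .
qed

section \<open>Properties of the averaged cut-offs\<close>

lemma finite_cell_mean:
  assumes "finite {x \<in> V. h x \<noteq> 0}"
  shows "finite {p \<in> cells. cell_mean h p \<noteq> 0}"
proof -
  let ?A = "{x \<in> V. h x \<noteq> 0}"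
  let ?E = "{(x, y) \<in> E. x \<in> ?A \<or> y \<in> ?A}"
  have E: "finite ?E" by (rule finite_edges_meeting[OF assms])
  have "finite {e \<in> E. edge_mean h e \<noteq> 0}"
    using E by (rule rev_finite_subset) (use E_subset in \<open>auto simp: edge_mean_def\<close>)
  moreover have "finite {t \<in> F. face_mean h t \<noteq> 0}"
    using finite_faces_meeting[OF E]
  proof (rule rev_finite_subset)
    \<comment> \<open>A face with nonzero mean has a vertex in the support of \<open>h\<close>,
      hence an edge meeting that support, and there are finitely many such edges.\<close>
    show "{t \<in> F. face_mean h t \<noteq> 0} \<subseteq> {(x, y, z) \<in> F. (x, y) \<in> ?E \<or> (y, z) \<in> ?E \<or> (z, x) \<in> ?E}"
    proof
      fix t assume "t \<in> {t \<in> F. face_mean h t \<noteq> 0}"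
      then obtain x y z where t: "t = (x, y, z)" "(x, y, z) \<in> F" and "face_mean h (x, y, z) \<noteq> 0"
        by (cases t) auto
      then have "h x \<noteq> 0 \<or> h y \<noteq> 0 \<or> h z \<noteq> 0" by (auto simp: face_mean_def)
      then show "t \<in> {(x, y, z) \<in> F. (x, y) \<in> ?E \<or> (y, z) \<in> ?E \<or> (z, x) \<in> ?E}"
        using F_edges[OF t(2)] E_subset t by auto
    qed
  qed
  ultimately show ?thesis
    using assms by (simp add: finite_Plus_Collect)
qed

lemma cell_mean_range:
  assumes "\<And>x. x \<in> V \<Longrightarrow> 0 \<le> h x \<and> h x \<le> 1" and p: "p \<in> cells"
  shows "0 \<le> cell_mean h p" "cell_mean h p \<le> 1"
proof -
  have *: "x \<in> V \<Longrightarrow> 0 \<le> h x" "x \<in> V \<Longrightarrow> h x \<le> 1" for x using assms by auto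
  have E: "0 \<le> edge_mean h e \<and> edge_mean h e \<le> 1" if "e \<in> E" for e
  proof -
    obtain x y where e: "e = (x, y)" by (cases e)
    then have "x \<in> V" "y \<in> V" using that E_subset by blast+
    then show ?thesis using *(1)[of x] *(1)[of y] *(2)[of x] *(2)[of y]
      by (simp add: e edge_mean_def)
  qed
  have F: "0 \<le> face_mean h t \<and> face_mean h t \<le> 1" if "t \<in> F" for t
  proof -
    obtain x y z where t: "t = (x, y, z)" by (cases t)
    then have "x \<in> V" "y \<in> V" "z \<in> V" using that F_edges E_subset by blast+
    then show ?thesis using *(1)[of x] *(1)[of y] *(1)[of z] *(2)[of x] *(2)[of y] *(2)[of z]
      by (simp add: t face_mean_def)
  qed
  show "0 \<le> cell_mean h p" "cell_mean h p \<le> 1"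
    using p E F * by auto
qed

lemma cell_mean_eventually:
  assumes h: "\<And>x. x \<in> V \<Longrightarrow> \<forall>\<^sub>F n in sequentially. h n x = 1" and p: "p \<in> cells"
  shows "\<forall>\<^sub>F n in sequentially. cell_mean (h n) p = 1"
  using p
proof (elim PlusE; hypsubst)
  fix x assume "x \<in> V"
  then show "\<forall>\<^sub>F n in sequentially. cell_mean (h n) (Inl x) = 1" using h by simp
next
  fix e assume "e \<in> E"
  then obtain x y where e: "e = (x, y)" "x \<in> V" "y \<in> V" using E_subset by (cases e) auto
  have "\<forall>\<^sub>F n in sequentially. edge_mean (h n) e = 1"
    using h[OF e(2)] h[OF e(3)] by eventually_elim (simp add: e edge_mean_def)
  then show "\<forall>\<^sub>F n in sequentially. cell_mean (h n) (Inr (Inl e)) = 1" by simp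
next
  fix t assume t: "t \<in> F"
  obtain x y z where xyz: "t = (x, y, z)" by (cases t)
  then have V: "x \<in> V" "y \<in> V" "z \<in> V" using t F_edges E_subset by blast+
  have "\<forall>\<^sub>F n in sequentially. face_mean (h n) t = 1"
    using h[OF V(1)] h[OF V(2)] h[OF V(3)] by eventually_elim (simp add: xyz face_mean_def)
  then show "\<forall>\<^sub>F n in sequentially. cell_mean (h n) (Inr (Inr t)) = 1" by simp
qed

theorem essentially_selfadjoint_gauss_bonnet:
  assumes "chi_complete V E F c r s"
  shows "essentially_selfadjoint (l2_T V E F c r s) (ip_T V E F c r s) (gb_domain V E F) T"
proof -
  obtain C B h where C: "C > 0" and B: "incseq B" "V = (\<Union>n. B n)"
    and cutoff: "\<forall>n. finite {x \<in> V. h n x \<noteq> 0} \<and> (\<forall>x\<in>V. 0 \<le> h n x \<and> h n x \<le> 1) \<and>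
      (\<forall>x\<in>B n. h n x = 1) \<and>
      (\<forall>x\<in>V. 1 / c x * (\<Sum>e\<in>{e \<in> E. snd e = x}. r e * \<bar>diff0 (h n) e\<bar>\<^sup>2) \<le> C) \<and>
      (\<forall>(x, y)\<in>E. 1 / r (x, y) * (\<Sum>t\<in>face_set F x y.
         s (x, y, t) * \<bar>diff0 (h n) (t, x) + diff0 (h n) (t, y)\<bar>\<^sup>2) \<le> C)"
    using assms unfolding chi_complete_def by (elim exE conjE) (rule that)
  then have fin: "finite {x \<in> V. h n x \<noteq> 0}"
    and range: "x \<in> V \<Longrightarrow> 0 \<le> h n x \<and> h n x \<le> 1"
    and one: "x \<in> B n \<Longrightarrow> h n x = 1"
    and CV: "x \<in> V \<Longrightarrow> 1 / c x * (\<Sum>e\<in>{e \<in> E. snd e = x}. r e * \<bar>diff0 (h n) e\<bar>\<^sup>2) \<le> C"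
    and CE: "(x, y) \<in> E \<Longrightarrow> 1 / r (x, y) * (\<Sum>t\<in>face_set F x y.
      s (x, y, t) * \<bar>diff0 (h n) (t, x) + diff0 (h n) (t, y)\<bar>\<^sup>2) \<le> C" for n x y
    using cutoff[THEN spec, of n] by blast+
  have bound: "cutoff_bound (h n) C" for n
    unfolding cutoff_bound_def
  proof (intro conjI ballI)
    fix e assume e: "e \<in> E"
    then show "1 / r e * (\<Sum>t\<in>{t \<in> F. face_edge t = e}. s t * (face_diff (h n) t)\<^sup>2) \<le> C"
      using CE[of "fst e" "snd e" n] sum_face_set[of "\<lambda>t. s t * (face_diff (h n) t)\<^sup>2" "fst e" "snd e"]
      by (simp add: face_diff_def)
  qed (use C CV in auto)
  \<comment> \<open>Since \<open>B\<close> is increasing, a vertex in \<open>B k\<close> stays in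
    all later sets, where the cut-off is 1.\<close>
  have ev: "\<forall>\<^sub>F n in sequentially. h n x = 1" if "x \<in> V" for x
  proof -
    from that B(2) obtain k where "x \<in> B k" by auto
    then show ?thesis
      using B(1) one unfolding eventually_sequentially by (meson incseqD subsetD)
  qed
  interpret cutoff_operator cells wt triple_coord "triple_space V E F" "gb_domain V E F"
    "l2_T V E F c r s" "ip_T V E F c r s" T "\<lambda>n. cell_mean (h n)" "\<lambda>n. mult_triple (h n)" "2 * C"
  proof unfold_locales
    show "\<forall>\<^sub>F n in sequentially. cell_mean (h n) p = 1" if "p \<in> cells" for p
      using ev that by (rule cell_mean_eventually)
    show "l2_le cells wt (\<lambda>p. triple_coord (T (mult_triple (h n) u)) p - triple_coord (mult_triple (h n) (T u)) p)
        (2 * C * B')" if "l2_le cells wt (triple_coord u) B'" for u n B'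
      using bound that by (rule gauss_bonnet_commutator)
  qed (use range fin in \<open>simp_all add: cell_weight_pos triple_coord_diff triple_space_diff
    gb_domain_eq[symmetric] l2_T_eq[symmetric] ip_T_eq gauss_bonnet_space gauss_bonnet_diff gauss_bonnet_domain
    gauss_bonnet_green finite_cell_mean cell_mean_range mult_triple_space triple_coord_mult
    triple_coord_inj\<close>)
  show ?thesis by (rule essentially_selfadjoint_cutoff)
qed

end

theorem theorem1:
  fixes V :: "'a set" and E :: "('a \<times> 'a) set" and \<alpha> :: "'a \<times> 'a \<Rightarrow> real"
    and F :: "('a \<times> 'a \<times> 'a) set"
    and c :: "'a \<Rightarrow> real" and r :: "'a \<times> 'a \<Rightarrow> real" and s :: "'a \<times> 'a \<times> 'a \<Rightarrow> real"
  assumes "weighted_magnetic_triangulation V E \<alpha> F c r s"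
    and "chi_complete V E F c r s"
  shows "essentially_selfadjoint (l2_T V E F c r s) (ip_T V E F c r s)
           (gb_domain V E F) (gauss_bonnet V E \<alpha> F c r s)"
  using assms by (rule weighted_magnetic_triangulation.essentially_selfadjoint_gauss_bonnet)

end
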